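(* Let $\mathcal{X}$ be a quasismooth complete intersection of type $(d_0,d_1,\ldots,d_m)$ in $\mathbb{P}^{\mathbf w}=\mathbb{P}(w_0,\ldots,w_n)$, let $F=\{\tfrac{a}{w_i}:0\le a<w_i,\ 0\le i\le n\}$, and let $k_{\mathcal{X}}=\sum_{j=0}^md_j-\sum_{i=0}^nw_i$. The following conditions on $\mathcal{X}$ are equivalent: (1) $\mathcal{X}$ is well-formed and has terminal singularities. (2) For all non-zero $f\in F$, either $\#\{j: d_jf\in\mathbb{Z}\}\ge\#\{i: w_if\in\mathbb{Z}\}$ or $$\sum_{i=0}^n\langle fw_i\rangle>1+\sum_{j=0}^m\langle fd_j\rangle .$$ In particular, if $k_{\mathcal{X}}\le0$ and $\mathcal{X}$ has terminal singularities, then the following condition $( * )$ is satisfied: for each non-zero $f\in F$, either $\sum_{j=0}^m\lceil fd_j\rceil-\sum_{i=0}^n\lceil fw_i\rceil<-1$ or $\#\{j: d_jf\in\mathbb{Z}\}\ge\#\{i: w_if\in\mathbb{Z}\}$. If $\mathcal{X}$ is Calabi--Yau, then condition $( * )$ is equivalent to $\mathcal{X}$ having terminal singularities.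
   Context: $w_0,\ldots,w_n$ are positive integers and $\mathbb{P}^{\mathbf w}=[(\mathbb{C}^{n+1}-\{0\})/\mathbb{C}^\times]$ with $\mathbb{C}^\times$ acting with weights $-w_0,\ldots,-w_n$. $\mathcal{X}$ is cut out by $m+1$ weighted-homogeneous polynomials of degrees $d_0,\ldots,d_m$; quasismooth means that the affine cone is smooth away from the origin, so that $\mathcal{X}$ is an orbifold whose isotropy groups are cyclic, and locally at a point with isotropy $\mu_r$ it is $\frac1r(a_1,\ldots,a_l)=\mathbb{C}^l/\mu_r$, with $l=\dim\mathcal{X}$ and $\mu_r$ acting with weights $a_1,\ldots,a_l$. For rational $x$, $\langle x\rangle=x-\lfloor x\rfloor$. The set of weights is well-formed if $\gcd(r,a_1,\ldots,\widehat{a_i},\ldots,a_l)=1$ for all $i$ (the action is faithful and has no quasi-reflections); $\mathcal{X}$ is well-formed if this holds at every point. By the Reid--Tai criterion (which may be taken as a definition), $\mathcal{X}$ is well-formed with terminal singularities if and only if at every point $\sum_{i=1}^l\langle ka_i/r\rangle>1$ for $k=1,2,\ldots,r-1$; in statements about $\mathcal{X}$ "having terminal singularities", well-formedness is understood. Calabi--Yau means $k_{\mathcal{X}}=0$. *)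

theory Defs
  imports "HOL-Analysis.Analysis" "HOL-Library.Poly_Mapping"
begin

text \<open>
  The coordinates \<open>0, \<dots>, n\<close> are indexed by a finite type \<open>'n\<close> and the defining equations
  \<open>0, \<dots>, m\<close> by a finite type \<open>'m\<close>. Linear algebra over the complex numbers on
  \<^typ>\<open>complex ^ 'n\<close> is that of the interpretation \<open>vec\<close>
  (\<open>vec.span\<close>, \<open>vec.independent\<close>), not the real one.
\<close>

type_synonym 'n mpoly = "('n \<Rightarrow>\<^sub>0 nat) \<Rightarrow>\<^sub>0 complex"

definition mpoly_eval :: "('n::finite) mpoly \<Rightarrow> complex ^ 'n \<Rightarrow> complex" where
  "mpoly_eval p x =
     (\<Sum>\<alpha>\<in>Poly_Mapping.keys p.
        Poly_Mapping.lookup p \<alpha> * (\<Prod>i\<in>UNIV. (x $ i) ^ Poly_Mapping.lookup \<alpha> i))"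

definition weighted_homogeneous :: "('n::finite \<Rightarrow> nat) \<Rightarrow> nat \<Rightarrow> 'n mpoly \<Rightarrow> bool" where
  "weighted_homogeneous w e p \<longleftrightarrow>
     (\<forall>\<alpha>\<in>Poly_Mapping.keys p. (\<Sum>i\<in>UNIV. Poly_Mapping.lookup \<alpha> i * w i) = e)"

definition affine_cone :: "('m::finite \<Rightarrow> ('n::finite) mpoly) \<Rightarrow> (complex ^ 'n) set" where
  "affine_cone P = {x. \<forall>j. mpoly_eval (P j) x = 0}"

definition jacobian :: "('m::finite \<Rightarrow> ('n::finite) mpoly) \<Rightarrow> complex ^ 'n \<Rightarrow> complex ^ 'n ^ 'm" where
  "jacobian P x = (\<chi> j i. deriv (\<lambda>z. mpoly_eval (P j) (x + axis i z)) 0)"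

text \<open>
  Full rank of the Jacobian matrix says that the scheme cut out by the equations is, at that
  point, smooth of codimension the number of equations. It covers both smoothness of the cone
  away from the origin and the condition that the intersection is complete.
\<close>

definition quasismooth_complete_intersection ::
  "('n::finite \<Rightarrow> nat) \<Rightarrow> ('m::finite \<Rightarrow> nat) \<Rightarrow> ('m \<Rightarrow> 'n mpoly) \<Rightarrow> bool" where
  "quasismooth_complete_intersection w d P \<longleftrightarrow>
     (\<forall>i. w i > 0) \<and> (\<forall>j. d j > 0) \<and>
     (\<forall>j. weighted_homogeneous w (d j) (P j)) \<and>
     (\<forall>x\<in>affine_cone P - {0}. rank (jacobian P x) = CARD('m))"

definition wact :: "('n::finite \<Rightarrow> nat) \<Rightarrow> complex \<Rightarrow> complex ^ 'n \<Rightarrow> complex ^ 'n" where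
  "wact w t x = (\<chi> i. t powi (- int (w i)) * x $ i)"

definition isotropy_group :: "('n::finite \<Rightarrow> nat) \<Rightarrow> complex ^ 'n \<Rightarrow> complex set" where
  "isotropy_group w x = {t. t \<noteq> 0 \<and> wact w t x = x}"

definition cone_tangent_space ::
  "('m::finite \<Rightarrow> ('n::finite) mpoly) \<Rightarrow> complex ^ 'n \<Rightarrow> (complex ^ 'n) set" where
  "cone_tangent_space P x = {v. jacobian P x *v v = 0}"

text \<open>Spans the tangent line at \<open>x\<close> of the orbit of \<open>x\<close>: it is minus the derivative of
  \<open>wact w t x\<close> with respect to \<open>t\<close> at \<open>t = 1\<close>.\<close>

definition euler_vector :: "('n::finite \<Rightarrow> nat) \<Rightarrow> complex ^ 'n \<Rightarrow> complex ^ 'n" where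
  "euler_vector w x = (\<chi> i. of_nat (w i) * x $ i)"

text \<open>
  \<open>local_quotient_type w P x r a\<close>: at the point \<open>[x]\<close> the stack is \<open>1/r (a\<^sub>1, \<dots>, a\<^sub>l)\<close>. The
  isotropy group is the group of \<open>r\<close>-th roots of unity, and the space on which it acts is the
  tangent space of the stack at \<open>[x]\<close>, that is, the tangent space of the cone modulo the
  tangent line of the orbit. The list \<open>v\<close> represents a basis of this quotient, of length
  \<open>l\<close>, on which \<open>t\<close> acts diagonally by \<open>t\<close> to the powers \<open>a\<^sub>1, \<dots>, a\<^sub>l\<close>. The weights are
  integers, determined up to order and modulo \<open>r\<close>.
\<close>

definition local_quotient_type ::
  "('n::finite \<Rightarrow> nat) \<Rightarrow> ('m::finite \<Rightarrow> 'n mpoly) \<Rightarrow> complex ^ 'n \<Rightarrow> nat \<Rightarrow> int list \<Rightarrow> bool" where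
  "local_quotient_type w P x r a \<longleftrightarrow>
     r > 0 \<and> isotropy_group w x = {t. t ^ r = 1} \<and>
     (\<exists>v. length v = length a \<and>
          distinct (euler_vector w x # v) \<and>
          vec.independent (set (euler_vector w x # v)) \<and>
          vec.span (set (euler_vector w x # v)) = cone_tangent_space P x \<and>
          (\<forall>i<length a. \<forall>t\<in>isotropy_group w x.
             wact w t (v ! i) - t powi (a ! i) *s v ! i \<in> vec.span {euler_vector w x}))"

definition well_formed_weights :: "nat \<Rightarrow> int list \<Rightarrow> bool" where
  "well_formed_weights r a \<longleftrightarrow>
     (\<forall>i<length a. Gcd (insert (int r) ((!) a ` ({..<length a} - {i}))) = 1)"

definition reid_tai :: "nat \<Rightarrow> int list \<Rightarrow> bool" where
  "reid_tai r a \<longleftrightarrow>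
     (\<forall>k\<in>{1..<r}. (\<Sum>i<length a. frac (real k * real_of_int (a ! i) / real r)) > 1)"

definition well_formed :: "('n::finite \<Rightarrow> nat) \<Rightarrow> ('m::finite \<Rightarrow> 'n mpoly) \<Rightarrow> bool" where
  "well_formed w P \<longleftrightarrow>
     (\<forall>x\<in>affine_cone P - {0}. \<forall>r a. local_quotient_type w P x r a \<longrightarrow> well_formed_weights r a)"

text \<open>The Reid--Tai criterion, taken as a definition; it characterises terminal singularities
  only in conjunction with \<^const>\<open>well_formed\<close>.\<close>

definition terminal_singularities :: "('n::finite \<Rightarrow> nat) \<Rightarrow> ('m::finite \<Rightarrow> 'n mpoly) \<Rightarrow> bool" where
  "terminal_singularities w P \<longleftrightarrow>
     (\<forall>x\<in>affine_cone P - {0}. \<forall>r a. local_quotient_type w P x r a \<longrightarrow> reid_tai r a)"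

definition weight_fractions :: "('n::finite \<Rightarrow> nat) \<Rightarrow> real set" where
  "weight_fractions w = {real a / real (w i) | a i. a < w i}"

definition canonical_degree :: "('n::finite \<Rightarrow> nat) \<Rightarrow> ('m::finite \<Rightarrow> nat) \<Rightarrow> int" where
  "canonical_degree w d = (\<Sum>j\<in>UNIV. int (d j)) - (\<Sum>i\<in>UNIV. int (w i))"

definition star_condition :: "('n::finite \<Rightarrow> nat) \<Rightarrow> ('m::finite \<Rightarrow> nat) \<Rightarrow> bool" where
  "star_condition w d \<longleftrightarrow>
     (\<forall>f\<in>weight_fractions w - {0}.
        (\<Sum>j\<in>UNIV. \<lceil>f * real (d j)\<rceil>) - (\<Sum>i\<in>UNIV. \<lceil>f * real (w i)\<rceil>) < - 1 \<or>
        card {j. real (d j) * f \<in> \<int>} \<ge> card {i. real (w i) * f \<in> \<int>})"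

end

theory Submission
  imports Defs "HOL-Computational_Algebra.Fundamental_Theorem_Algebra"
begin

text \<open>
  At a point \<open>x\<close> with isotropy \<open>\<mu>\<^sub>r\<close> the Jacobian is an equivariant surjection from the sum of the
  characters \<open>- w i\<close> onto the sum of the characters \<open>- d j\<close>, and its kernel is the tangent space of
  the stack together with the invariant Euler direction. So modulo \<open>r\<close> the weights
  \<open>- w i\<close> are, as a multiset, the local weights, one \<open>0\<close> and the \<open>- d j\<close>. With \<open>f = (r - k) / r\<close> this
  turns the Reid--Tai sum for \<open>k\<close> into the difference of the two sums of fractional parts in
  (2), and it shows that fewer \<open>d j f\<close> than \<open>w i f\<close> are integers. Conversely, if fewer \<open>d j f\<close>
  than \<open>w i f\<close> are integers, then the cone meets the coordinate subspace where
  \<open>w i f\<close> is an integer outside the origin, because the remaining equations vanish identically there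
  and the others are too few: a graded dimension count and the Nullstellensatz give a common zero.
  The statements on the starred condition follow by exchanging \<open>f\<close> and \<open>1 - f\<close>.
\<close>

section \<open>The Nullstellensatz\<close>

text \<open>A ring as a module over itself: subspaces are ideals, and \<open>ideal.span Q\<close> is
  the ideal generated by \<open>Q\<close>.\<close>

interpretation ideal: module "(*) :: 'a::comm_ring_1 \<Rightarrow> 'a \<Rightarrow> 'a"
  by standard (auto simp: algebra_simps)

text \<open>As a rewrite rule this fights with \<open>mult.assoc\<close> in every commutative ring.\<close>
declare ideal.scale_scale [simp del]

text \<open>Zorn's lemma for the ideals that contain \<open>I\<close> and avoid all powers of
  \<open>s\<close>. Adding \<open>g\<close> to a maximal one produces a power of \<open>s\<close>,
  so \<open>M\<close> behaves like a maximal ideal after inverting \<open>s\<close>.\<close>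

lemma maximal_ideal_avoiding_powers:
  fixes s :: "'a::comm_ring_1"
  assumes "ideal.subspace I" and "\<And>k. s ^ k \<notin> I"
  obtains M where "ideal.subspace M" "I \<subseteq> M" "\<And>k. s ^ k \<notin> M"
    "\<And>g. g \<notin> M \<Longrightarrow> \<exists>h k. h * g - s ^ k \<in> M"
proof -
  define \<A> where "\<A> = {J. ideal.subspace J \<and> I \<subseteq> J \<and> (\<forall>k. s ^ k \<notin> J)}"
  have "\<exists>M\<in>\<A>. \<forall>X\<in>\<A>. M \<subseteq> X \<longrightarrow> X = M"
  proof (rule subset_Zorn_nonempty)
    show "\<A> \<noteq> {}" using assms by (auto simp: \<A>_def)
  next
    fix \<C> assume ne: "\<C> \<noteq> {}" and ch: "subset.chain \<A> \<C>"
    have sub: "\<C> \<subseteq> \<A>" using ch by (simp add: subset.chain_def)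
    have "ideal.subspace (\<Union>\<C>)"
    proof (rule ideal.subspaceI)
      show "0 \<in> \<Union>\<C>" using ne sub by (auto simp: \<A>_def ideal.subspace_def)
    next
      fix x y assume "x \<in> \<Union>\<C>" "y \<in> \<Union>\<C>"
      then obtain X Y where "X \<in> \<C>" "x \<in> X" "Y \<in> \<C>" "y \<in> Y" by blast
      moreover have "X \<subseteq> Y \<or> Y \<subseteq> X" using ch calculation by (auto simp: subset.chain_def)
      ultimately obtain Z where Z: "Z \<in> \<C>" "x \<in> Z" "y \<in> Z" by blast
      hence "x + y \<in> Z" using sub by (auto simp: \<A>_def intro: ideal.subspace_add)
      thus "x + y \<in> \<Union>\<C>" using Z by blast
    next
      fix c x assume "x \<in> \<Union>\<C>"
      then obtain X where X: "X \<in> \<C>" "x \<in> X" by blast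
      hence "c * x \<in> X" using sub by (auto simp: \<A>_def intro: ideal.subspace_scale)
      thus "c * x \<in> \<Union>\<C>" using X by blast
    qed
    thus "\<Union>\<C> \<in> \<A>" using sub ne by (auto simp: \<A>_def)
  qed
  then obtain M where M: "ideal.subspace M" "I \<subseteq> M" "\<And>k. s ^ k \<notin> M"
    and max: "\<And>X. X \<in> \<A> \<Longrightarrow> M \<subseteq> X \<Longrightarrow> X = M"
    by (auto simp: \<A>_def)
  have "\<exists>h k. h * g - s ^ k \<in> M" if g: "g \<notin> M" for g
  proof (rule ccontr)
    assume no: "\<not> ?thesis"
    define X where "X = ideal.span (insert g M)"
    have spanM: "ideal.span M = M" using M(1) by simp
    have "s ^ k \<notin> X" for k
    proof
      assume "s ^ k \<in> X"
      then obtain c where "s ^ k - c * g \<in> M"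
        by (auto simp: X_def ideal.span_breakdown_eq spanM)
      hence "- (s ^ k - c * g) \<in> M" using M(1) ideal.subspace_neg by blast
      thus False using no by auto
    qed
    moreover have "insert g M \<subseteq> X" by (simp only: X_def ideal.span_superset)
    ultimately have "X \<in> \<A>" using M by (auto simp: \<A>_def X_def)
    hence "X = M" using max \<open>insert g M \<subseteq> X\<close> by blast
    thus False using \<open>insert g M \<subseteq> X\<close> g by blast
  qed
  thus thesis using that M by blast
qed

text \<open>Every element outside \<open>M\<close> divides a power of \<open>s\<close> modulo
  \<open>M\<close>. If both \<open>a\<close> and \<open>b\<close> do, so does \<open>a * b\<close>,
  and \<open>a * b\<close> in \<open>M\<close> would then put a power of \<open>s\<close> in
  \<open>M\<close>.\<close>

lemma prime_if_maximal_avoiding_powers: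
  fixes s :: "'a::comm_ring_1"
  assumes M: "ideal.subspace M" and s: "\<And>k. s ^ k \<notin> M"
    and max: "\<And>g. g \<notin> M \<Longrightarrow> \<exists>h k. h * g - s ^ k \<in> M"
    and ab: "a * b \<in> M"
  shows "a \<in> M \<or> b \<in> M"
proof (rule ccontr)
  assume "\<not> ?thesis"
  then obtain h k h' k' where h: "h * a - s ^ k \<in> M" "h' * b - s ^ k' \<in> M"
    using max by blast
  have "(h * h') * (a * b) - (h' * b) * (h * a - s ^ k) - s ^ k * (h' * b - s ^ k') \<in> M"
    by (rule ideal.subspace_diff[OF M ideal.subspace_diff[OF M
          ideal.subspace_scale[OF M ab] ideal.subspace_scale[OF M h(1)]] ideal.subspace_scale[OF M h(2)]])
  also have "(h * h') * (a * b) - (h' * b) * (h * a - s ^ k) - s ^ k * (h' * b - s ^ k') = s ^ (k + k')"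
    unfolding power_add by (simp only: right_diff_distrib mult_ac) simp
  finally show False using s[of "k + k'"] by simp
qed

section \<open>Polynomials as a complex vector space with the monomials as a basis\<close>

definition mconst :: "complex \<Rightarrow> 'n mpoly" where "mconst c = Poly_Mapping.single 0 c"

definition mmonom :: "('n \<Rightarrow>\<^sub>0 nat) \<Rightarrow> 'n mpoly" where "mmonom \<alpha> = Poly_Mapping.single \<alpha> 1"

definition mvar :: "'n \<Rightarrow> 'n mpoly" where "mvar i = mmonom (Poly_Mapping.single i 1)"

lemma mconst_0 [simp]: "mconst 0 = 0" and mconst_1 [simp]: "mconst 1 = 1"
  by (simp_all add: mconst_def)

lemma mconst_add: "mconst (a + b) = mconst a + mconst b"
  by (simp add: mconst_def single_add)

lemma mconst_uminus: "mconst (- a) = - mconst a"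
  by (simp add: mconst_def single_uminus)

lemma mconst_diff: "mconst (a - b) = mconst a - mconst b"
  by (simp add: mconst_def single_diff)

lemma mconst_mult: "mconst (a * b) = mconst a * mconst b"
  by (simp add: mconst_def mult_single)

lemma inj_mmonom: "inj (mmonom :: ('n \<Rightarrow>\<^sub>0 nat) \<Rightarrow> _)"
proof (rule injI)
  fix \<alpha> \<beta> :: "'n \<Rightarrow>\<^sub>0 nat" assume "mmonom \<alpha> = mmonom \<beta>"
  hence "Poly_Mapping.keys (mmonom \<alpha>) = Poly_Mapping.keys (mmonom \<beta>)" by simp
  thus "\<alpha> = \<beta>" by (simp add: mmonom_def)
qed

lemma mmonom_0 [simp]: "mmonom 0 = 1"
  by (simp add: mmonom_def)

lemma mmonom_add: "mmonom (\<alpha> + \<beta>) = mmonom \<alpha> * mmonom \<beta>"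
  by (simp add: mmonom_def mult_single)

lemma lookup_mconst_mult:
  "Poly_Mapping.lookup (mconst c * p) \<alpha> = c * Poly_Mapping.lookup p \<alpha>"
  by (simp add: mconst_def flip: mult_map_scale_conv_mult) (simp add: map.rep_eq when_def)

lemma mpoly_expand:
  "p = (\<Sum>\<alpha>\<in>Poly_Mapping.keys p. mconst (Poly_Mapping.lookup p \<alpha>) * mmonom \<alpha>)"
proof (rule poly_mapping_eqI)
  fix \<beta>
  have "Poly_Mapping.lookup (\<Sum>\<alpha>\<in>Poly_Mapping.keys p. mconst (Poly_Mapping.lookup p \<alpha>) * mmonom \<alpha>) \<beta>
      = (\<Sum>\<alpha>\<in>Poly_Mapping.keys p. if \<alpha> = \<beta> then Poly_Mapping.lookup p \<beta> else 0)"
    unfolding lookup_sum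
    by (rule sum.cong) (auto simp: lookup_mconst_mult mmonom_def lookup_single)
  also have "\<dots> = Poly_Mapping.lookup p \<beta>"
    by (simp add: in_keys_iff)
  finally show "Poly_Mapping.lookup p \<beta> = Poly_Mapping.lookup
      (\<Sum>\<alpha>\<in>Poly_Mapping.keys p. mconst (Poly_Mapping.lookup p \<alpha>) * mmonom \<alpha>) \<beta>" ..
qed

lemma mvar_power: "mvar i ^ k = mmonom (Poly_Mapping.single i k)"
proof (induction k)
  case (Suc k)
  have "mmonom (Poly_Mapping.single i (Suc k)) = mmonom (Poly_Mapping.single i 1 + Poly_Mapping.single i k)"
    by (simp flip: single_add)
  thus ?case using Suc by (simp add: mvar_def mmonom_add)
qed simp

lemma mmonom_eq_prod: "mmonom \<alpha> = (\<Prod>i\<in>UNIV. mvar i ^ Poly_Mapping.lookup \<alpha> i)"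
  for \<alpha> :: "'n::finite \<Rightarrow>\<^sub>0 nat"
proof -
  have prod: "(\<Prod>i\<in>A. mmonom (f i)) = mmonom (\<Sum>i\<in>A. f i)" if "finite A"
    for A :: "'n set" and f
    using that by (induction A) (simp_all add: mmonom_add)
  have "\<alpha> = (\<Sum>i\<in>UNIV. Poly_Mapping.single i (Poly_Mapping.lookup \<alpha> i))"
    by (rule poly_mapping_eqI) (auto simp: lookup_sum lookup_single when_def)
  hence "mmonom \<alpha> = mmonom (\<Sum>i\<in>UNIV. Poly_Mapping.single i (Poly_Mapping.lookup \<alpha> i))"
    by (rule arg_cong)
  also have "\<dots> = (\<Prod>i\<in>UNIV. mmonom (Poly_Mapping.single i (Poly_Mapping.lookup \<alpha> i)))"
    by (rule prod[symmetric]) simp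
  finally show ?thesis unfolding mvar_power .
qed

text \<open>Scalars act through the constant polynomials, so \<open>mpoly.span\<close> is the
  complex linear span, whereas \<open>ideal.span\<close> allows polynomial coefficients.\<close>

interpretation mpoly: vector_space "\<lambda>c p. mconst c * (p :: 'n mpoly)"
  by standard (simp_all only: distrib_left distrib_right mconst_add mconst_mult mult.assoc mconst_1 mult_1_left)

declare mpoly.scale_scale [simp del]

lemma independent_mmonom: "mpoly.independent (mmonom ` A)"
  unfolding mpoly.independent_explicit_finite_subsets
proof (intro allI impI ballI)
  fix S u v assume S: "S \<subseteq> mmonom ` A" "finite S" and 0: "(\<Sum>v\<in>S. mconst (u v) * v) = 0"
    and v: "v \<in> S"
  obtain \<alpha> where \<alpha>: "v = mmonom \<alpha>" using S v by blast
  have "0 = Poly_Mapping.lookup (\<Sum>v\<in>S. mconst (u v) * v) \<alpha>" using 0 by simp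
  also have "\<dots> = (\<Sum>x\<in>S. if x = v then u v else 0)"
    unfolding lookup_sum
  proof (rule sum.cong)
    fix x assume "x \<in> S"
    then obtain \<beta> where "x = mmonom \<beta>" using S by blast
    thus "Poly_Mapping.lookup (mconst (u x) * x) \<alpha> = (if x = v then u v else 0)"
      using injD[OF inj_mmonom, of \<alpha> \<beta>] by (auto simp: \<alpha> lookup_mconst_mult mmonom_def lookup_single when_def)
  qed simp
  also have "\<dots> = u v" using v S by simp
  finally show "u v = 0" by simp
qed

text \<open>Each exponent is bounded separately, not the total degree, so the size of the box is an
  exact power.\<close>

definition exponent_box :: "nat \<Rightarrow> ('n::finite \<Rightarrow>\<^sub>0 nat) set" where
  "exponent_box s = {\<alpha>. \<forall>i. Poly_Mapping.lookup \<alpha> i \<le> s}"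

lemma bij_betw_exponent_box:
  "bij_betw Poly_Mapping.lookup (exponent_box s :: ('n::finite \<Rightarrow>\<^sub>0 nat) set) (PiE UNIV (\<lambda>_. {..s}))"
  unfolding bij_betw_def
proof
  show "inj_on Poly_Mapping.lookup (exponent_box s :: ('n \<Rightarrow>\<^sub>0 nat) set)"
    by (simp add: inj_on_def lookup_inject)
  show "Poly_Mapping.lookup ` (exponent_box s :: ('n \<Rightarrow>\<^sub>0 nat) set) = PiE UNIV (\<lambda>_. {..s})"
  proof (intro equalityI subsetI)
    fix f :: "'n \<Rightarrow> nat" assume "f \<in> PiE UNIV (\<lambda>_. {..s})"
    thus "f \<in> Poly_Mapping.lookup ` exponent_box s"
      by (intro image_eqI[of _ _ "Abs_poly_mapping f"]) (auto simp: exponent_box_def PiE_def Pi_def)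
  qed (auto simp: exponent_box_def)
qed

lemma finite_exponent_box: "finite (exponent_box s)"
  by (simp add: bij_betw_finite[OF bij_betw_exponent_box] finite_PiE)

lemma card_exponent_box: "card (exponent_box s :: ('n::finite \<Rightarrow>\<^sub>0 nat) set) = Suc s ^ CARD('n)"
  using bij_betw_same_card[OF bij_betw_exponent_box] by (simp add: card_PiE)

lemma ex_exponent_box: "\<exists>D. Poly_Mapping.keys p \<subseteq> exponent_box D" for p :: "'n::finite mpoly"
proof -
  define D where "D = (\<Sum>\<alpha>\<in>Poly_Mapping.keys p. \<Sum>i\<in>UNIV. Poly_Mapping.lookup \<alpha> i)"
  have "Poly_Mapping.lookup \<alpha> i \<le> D" if "\<alpha> \<in> Poly_Mapping.keys p" for \<alpha> i
  proof -
    have "Poly_Mapping.lookup \<alpha> i \<le> (\<Sum>i\<in>UNIV. Poly_Mapping.lookup \<alpha> i)"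
      by (rule member_le_sum) auto
    also have "\<dots> \<le> D"
      unfolding D_def by (rule member_le_sum[OF that]) auto
    finally show ?thesis .
  qed
  thus ?thesis by (auto simp: exponent_box_def)
qed

lemma mpoly_in_span: "p \<in> mpoly.span (mmonom ` A)" if "Poly_Mapping.keys p \<subseteq> A"
proof -
  have "(\<Sum>\<alpha>\<in>Poly_Mapping.keys p. mconst (Poly_Mapping.lookup p \<alpha>) * mmonom \<alpha>) \<in> mpoly.span (mmonom ` A)"
    by (rule mpoly.span_sum, rule mpoly.span_scale, rule mpoly.span_base) (use that in blast)
  thus ?thesis by (simp flip: mpoly_expand)
qed

section \<open>Substitution into univariate polynomials\<close>

definition subst_mpoly :: "'n mpoly \<Rightarrow> complex poly \<Rightarrow> 'n mpoly" where
  "subst_mpoly x q = poly (map_poly mconst q) x"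

lemma subst_mpoly_0 [simp]: "subst_mpoly x 0 = 0"
  by (simp add: subst_mpoly_def)

lemma subst_mpoly_pCons [simp]: "subst_mpoly x (pCons a q) = mconst a + x * subst_mpoly x q"
  by (simp add: subst_mpoly_def map_poly_pCons)

lemma subst_mpoly_add: "subst_mpoly x (p + q) = subst_mpoly x p + subst_mpoly x q"
  by (induction p q rule: poly_induct2) (simp_all add: distrib_left mconst_add add_ac)

lemma subst_mpoly_smult: "subst_mpoly x (smult c p) = mconst c * subst_mpoly x p"
  by (induction p) (simp_all add: distrib_left mconst_mult mult.left_commute)

lemma subst_mpoly_mult: "subst_mpoly x (p * q) = subst_mpoly x p * subst_mpoly x q"
  by (induction p) (simp_all add: distrib_right mult.assoc subst_mpoly_add subst_mpoly_smult)

lemma subst_mpoly_sum: "subst_mpoly x (sum f A) = (\<Sum>a\<in>A. subst_mpoly x (f a))"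
  by (induction A rule: infinite_finite_induct) (simp_all add: subst_mpoly_add)

text \<open>The fundamental theorem of algebra splits \<open>q\<close> into linear factors, and
  primality puts one of them, evaluated at \<open>x\<close>, in \<open>M\<close>. A non-zero
  constant is a unit and cannot lie in \<open>M\<close>.\<close>

lemma subst_mpoly_in_prime:
  assumes prime: "\<And>a b. a * b \<in> M \<Longrightarrow> a \<in> M \<or> b \<in> M" and M: "ideal.subspace M" "1 \<notin> M"
    and "q \<noteq> 0" "subst_mpoly x q \<in> M"
  shows "\<exists>c. x - mconst c \<in> M"
  using assms(4,5)
proof (induction "degree q" arbitrary: q)
  case 0
  then obtain a where "q = [:a:]" "a \<noteq> 0" by (metis pCons_0_0 degree_eq_zeroE)
  hence "mconst (inverse a) * mconst a \<in> M" using 0 M by (auto intro: ideal.subspace_scale)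
  thus ?case using \<open>a \<noteq> 0\<close> M by (simp flip: mconst_mult)
next
  case (Suc n)
  have "\<not> constant (poly q)" using Suc by (simp add: constant_degree)
  then obtain c where "poly q c = 0" using fundamental_theorem_of_algebra by blast
  then obtain q' where q': "q = [:- c, 1:] * q'" by (auto simp: poly_eq_0_iff_dvd)
  have "q' \<noteq> 0" using q' Suc by auto
  hence "degree q = Suc (degree q')" unfolding q' by (subst degree_mult_eq) auto
  hence "n = degree q'" using Suc by simp
  have "(x - mconst c) * subst_mpoly x q' \<in> M"
    using Suc(4) unfolding q' subst_mpoly_mult by (simp add: mconst_uminus algebra_simps)
  thus ?case using prime Suc(1) \<open>n = degree q'\<close> \<open>q' \<noteq> 0\<close> by blast
qed

text \<open>Uncountability of the complex numbers replaces Noether normalisation: if \<open>x - c\<close> were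
  invertible modulo \<open>M\<close> up to powers of \<open>s\<close> for every \<open>c\<close>, then infinitely many of the
  inverses would lie in one finite-dimensional space of polynomials, and a linear relation
  between them would make \<open>x\<close> algebraic over the complex numbers.\<close>

lemma mpoly_constant_mod_maximal:
  fixes s x :: "'n::finite mpoly"
  assumes M: "ideal.subspace M" and s: "\<And>k. s ^ k \<notin> M"
    and max: "\<And>g. g \<notin> M \<Longrightarrow> \<exists>h k. h * g - s ^ k \<in> M"
  shows "\<exists>c. x - mconst c \<in> M"
proof (rule ccontr)
  assume no: "\<nexists>c. x - mconst c \<in> M"
  note prime = prime_if_maximal_avoiding_powers[OF M s max]
  have one: "1 \<notin> M" using s[of 0] by simp
  from no max have "\<forall>c. \<exists>h k. h * (x - mconst c) - s ^ k \<in> M" by blast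
  then obtain h k where hk: "\<And>c. h c * (x - mconst c) - s ^ k c \<in> M" by metis
  have "\<forall>c. \<exists>D. Poly_Mapping.keys (h c) \<subseteq> exponent_box D"
    using ex_exponent_box by blast
  then obtain D where D: "\<And>c. Poly_Mapping.keys (h c) \<subseteq> exponent_box (D c)"
    by metis
  \<comment> \<open>Countably many pairs of an exponent and a box size cover the uncountably many
    \<open>c\<close>.\<close>
  have "\<exists>K E. infinite {c. k c = K \<and> D c = E}"
  proof (rule ccontr)
    assume "\<not> ?thesis"
    hence "countable (\<Union>K. \<Union>E. {c. k c = K \<and> D c = E})"
      by (intro countable_UN) (auto intro: countable_finite)
    moreover have "(\<Union>K. \<Union>E. {c. k c = K \<and> D c = E}) = UNIV" by auto
    ultimately show False using uncountable_UNIV_complex by simp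
  qed
  then obtain K E where inf: "infinite {c. k c = K \<and> D c = E}" by blast
  define B where "B = (exponent_box E :: ('n \<Rightarrow>\<^sub>0 nat) set)"
  \<comment> \<open>One element more than the monomials spanning the space in which all these
    \<open>h c\<close> lie.\<close>
  obtain C where C: "finite C" "card C = Suc (card B)" "C \<subseteq> {c. k c = K \<and> D c = E}"
    using infinite_arbitrarily_large[OF inf] by blast
  have hC: "h c * (x - mconst c) - s ^ K \<in> M" if "c \<in> C" for c using hk[of c] that C by auto
  \<comment> \<open>If \<open>h c = h c'\<close>, the difference of the two relations is
    \<open>c' - c\<close> times \<open>h c\<close>, so \<open>h c\<close> and with it
    \<open>s ^ K\<close> would lie in \<open>M\<close>.\<close>
  have inj: "inj_on h C"
  proof (rule inj_onI, rule ccontr)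
    fix c c' assume c: "c \<in> C" "c' \<in> C" "h c = h c'" "c \<noteq> c'"
    have "(h c * (x - mconst c) - s ^ K) - (h c * (x - mconst c') - s ^ K) \<in> M"
      using ideal.subspace_diff[OF M hC[OF c(1)] hC[OF c(2)]] c(3) by simp
    also have "(h c * (x - mconst c) - s ^ K) - (h c * (x - mconst c') - s ^ K) = mconst (c' - c) * h c"
      by (simp add: mconst_diff algebra_simps)
    finally have "mconst (inverse (c' - c)) * (mconst (c' - c) * h c) \<in> M"
      by (rule ideal.subspace_scale[OF M])
    also have "mconst (inverse (c' - c)) * (mconst (c' - c) * h c) = h c"
      using c by (simp flip: mult.assoc mconst_mult)
    finally have "h c \<in> M" .
    hence "(x - mconst c) * h c - (h c * (x - mconst c) - s ^ K) \<in> M"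
      by (intro ideal.subspace_diff[OF M] ideal.subspace_scale[OF M] hC c)
    thus False using s[of K] by (simp add: mult.commute)
  qed
  have "mpoly.dependent (h ` C)"
  proof (rule ccontr)
    assume "mpoly.independent (h ` C)"
    moreover have "h ` C \<subseteq> mpoly.span (mmonom ` B)"
      using D C by (fastforce intro: mpoly_in_span simp: B_def)
    moreover have "finite (mmonom ` B)" by (simp add: B_def finite_exponent_box)
    ultimately have "card (h ` C) \<le> card (mmonom ` B)"
      using mpoly.independent_span_bound by blast
    also have "\<dots> \<le> card B" by (simp add: B_def card_image_le finite_exponent_box)
    finally show False using C by (simp add: card_image[OF inj])
  qed
  then obtain U c0 where "c0 \<in> C" "U (h c0) \<noteq> 0" "(\<Sum>c\<in>C. mconst (U (h c)) * h c) = 0"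
    using C inj by (auto simp: mpoly.dependent_finite sum.reindex)
  then obtain u where c0: "c0 \<in> C" "u c0 \<noteq> 0" and u: "(\<Sum>c\<in>C. mconst (u c) * h c) = 0"
    using that[of "\<lambda>c. U (h c)"] by blast
  \<comment> \<open>The numerator of the partial fraction sum of \<open>u c / (X - c)\<close>. Since
    \<open>h c\<close> stands for \<open>s ^ K / (x - c)\<close> modulo \<open>M\<close>, clearing
    denominators in the relation of the \<open>h c\<close> gives \<open>s ^ K\<close> times the
    value of \<open>q\<close> at \<open>x\<close>.\<close>
  define q where "q = (\<Sum>c\<in>C. smult (u c) (\<Prod>c'\<in>C - {c}. [:- c', 1:]))"
  \<comment> \<open>At \<open>c0\<close> every product for another \<open>c\<close> has a zero
    factor, so one summand survives.\<close>
  have "poly q c0 = (\<Sum>c\<in>C. if c = c0 then u c0 * (\<Prod>c'\<in>C - {c0}. c0 - c') else 0)"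
    unfolding q_def poly_sum
  proof (rule sum.cong)
    fix c assume "c \<in> C"
    show "poly (smult (u c) (\<Prod>c'\<in>C - {c}. [:- c', 1:])) c0
        = (if c = c0 then u c0 * (\<Prod>c'\<in>C - {c0}. c0 - c') else 0)"
      using C c0 by (auto simp: poly_prod)
  qed simp
  also have "\<dots> \<noteq> 0" using C c0 by simp
  finally have "q \<noteq> 0" by auto
  have "s ^ K * subst_mpoly x q \<in> M"
  proof -
    define R where "R c = subst_mpoly x (\<Prod>c'\<in>C - {c}. [:- c', 1:])" for c
    define RR where "RR = subst_mpoly x (\<Prod>c'\<in>C. [:- c', 1:])"
    have R: "(x - mconst c) * R c = RR" if "c \<in> C" for c
      unfolding R_def RR_def prod.remove[OF C(1) that] subst_mpoly_mult
      by (simp add: mconst_uminus algebra_simps)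
    have "s ^ K * subst_mpoly x q = (\<Sum>c\<in>C. mconst (u c) * R c * s ^ K)"
      by (simp add: q_def subst_mpoly_sum subst_mpoly_smult R_def sum_distrib_left mult_ac)
    also have "\<dots> = RR * (\<Sum>c\<in>C. mconst (u c) * h c)
        - (\<Sum>c\<in>C. mconst (u c) * R c * (h c * (x - mconst c) - s ^ K))"
      unfolding sum_distrib_left sum_subtractf[symmetric]
      by (rule sum.cong) (auto simp: algebra_simps simp flip: R)
    also have "\<dots> = - (\<Sum>c\<in>C. mconst (u c) * R c * (h c * (x - mconst c) - s ^ K))"
      using u by simp
    also have "\<dots> \<in> M"
      by (intro ideal.subspace_neg[OF M] ideal.subspace_sum[OF M] ideal.subspace_scale[OF M] hC)
    finally show ?thesis .
  qed
  hence "subst_mpoly x q \<in> M" using prime s by blast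
  thus False using subst_mpoly_in_prime[OF prime M one \<open>q \<noteq> 0\<close>] no by blast
qed

text \<open>Modulo an ideal maximal among those avoiding the powers of the variable
  \<open>i\<close>, each variable is congruent to a constant. These constants are the coordinates of
  \<open>x\<close>; if the \<open>i\<close>-th were zero, the variable itself would lie in the
  ideal.\<close>

theorem nullstellensatz:
  fixes Q :: "'n::finite mpoly set" and i :: 'n
  assumes "\<And>k. mvar i ^ k \<notin> ideal.span Q"
  obtains x where "\<And>q. q \<in> Q \<Longrightarrow> mpoly_eval q x = 0" "x $ i \<noteq> 0"
proof -
  obtain M where M: "ideal.subspace M" "ideal.span Q \<subseteq> M" "\<And>k. mvar i ^ k \<notin> M"
    and max: "\<And>g. g \<notin> M \<Longrightarrow> \<exists>h k. h * g - mvar i ^ k \<in> M"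
    using maximal_ideal_avoiding_powers[OF ideal.subspace_span assms] by metis
  have "\<forall>j. \<exists>c. mvar j - mconst c \<in> M"
    using mpoly_constant_mod_maximal[OF M(1,3) max] by blast
  then obtain c where c: "\<And>j. mvar j - mconst (c j) \<in> M" by metis
  define x where "x = (\<chi> j. c j)"
  have times: "a * b - a' * b' \<in> M" if "a - a' \<in> M" "b - b' \<in> M" for a b a' b'
  proof -
    have "b * (a - a') + a' * (b - b') \<in> M"
      using that M(1) by (blast intro: ideal.subspace_add ideal.subspace_scale)
    thus ?thesis by (simp add: algebra_simps)
  qed
  have pow: "mvar j ^ k - mconst (c j ^ k) \<in> M" for j k
    by (induction k) (use c M(1) in \<open>auto simp: mconst_mult intro: times ideal.subspace_0\<close>)
  have prod: "(\<Prod>j\<in>A. mvar j ^ e j) - mconst (\<Prod>j\<in>A. c j ^ e j) \<in> M" for A e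
    by (induction A rule: infinite_finite_induct)
       (use pow M(1) in \<open>auto simp: mconst_mult intro: times ideal.subspace_0\<close>)
  have msum: "mconst (\<Sum>a\<in>A. f a) = (\<Sum>a\<in>A. mconst (f a))" for f :: "('n \<Rightarrow>\<^sub>0 nat) \<Rightarrow> complex" and A
    by (induction A rule: infinite_finite_induct) (auto simp: mconst_add)
  \<comment> \<open>Congruence modulo \<open>M\<close> respects sums and products, so each
    polynomial is congruent to its value at \<open>x\<close>.\<close>
  have ev: "q - mconst (mpoly_eval q x) \<in> M" for q
  proof -
    have "q - mconst (mpoly_eval q x) = (\<Sum>\<alpha>\<in>Poly_Mapping.keys q.
       mconst (Poly_Mapping.lookup q \<alpha>) * (mmonom \<alpha> - mconst (\<Prod>j\<in>UNIV. c j ^ Poly_Mapping.lookup \<alpha> j)))"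
      by (subst mpoly_expand[of q])
         (simp add: mpoly_eval_def msum x_def mconst_mult right_diff_distrib sum_subtractf)
    also have "\<dots> \<in> M" unfolding mmonom_eq_prod
      by (intro ideal.subspace_sum[OF M(1)] ideal.subspace_scale[OF M(1)] prod)
    finally show ?thesis .
  qed
  show thesis
  proof
    fix q assume "q \<in> Q"
    hence "q \<in> M" using M(2) ideal.span_base by blast
    hence "q - (q - mconst (mpoly_eval q x)) \<in> M" using ev M(1) by (blast intro: ideal.subspace_diff)
    hence "mconst (inverse (mpoly_eval q x)) * mconst (mpoly_eval q x) \<in> M"
      using M(1) by (auto intro: ideal.subspace_scale)
    thus "mpoly_eval q x = 0" using M(3)[of 0] by (cases "mpoly_eval q x = 0") (auto simp flip: mconst_mult)
  next
    show "x $ i \<noteq> 0" using c[of i] M(3)[of 1] by (auto simp: x_def)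
  qed
qed

section \<open>Weighted homogeneous equations\<close>

definition weighted_degree :: "('n::finite \<Rightarrow> nat) \<Rightarrow> ('n \<Rightarrow>\<^sub>0 nat) \<Rightarrow> nat" where
  "weighted_degree w \<alpha> = (\<Sum>i\<in>UNIV. Poly_Mapping.lookup \<alpha> i * w i)"

lemma weighted_degree_add: "weighted_degree w (\<alpha> + \<beta>) = weighted_degree w \<alpha> + weighted_degree w \<beta>"
  by (simp add: weighted_degree_def lookup_add distrib_right sum.distrib)

definition homogeneous_part :: "('n::finite \<Rightarrow> nat) \<Rightarrow> nat \<Rightarrow> 'n mpoly \<Rightarrow> 'n mpoly" where
  "homogeneous_part w D p = Abs_poly_mapping (\<lambda>\<alpha>. if weighted_degree w \<alpha> = D then Poly_Mapping.lookup p \<alpha> else 0)"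

lemma lookup_homogeneous_part:
  "Poly_Mapping.lookup (homogeneous_part w D p) \<alpha> =
     (if weighted_degree w \<alpha> = D then Poly_Mapping.lookup p \<alpha> else 0)"
proof -
  have "finite {\<alpha>. (if weighted_degree w \<alpha> = D then Poly_Mapping.lookup p \<alpha> else 0) \<noteq> 0}"
    by (rule finite_subset[OF _ finite_keys[of p]]) (auto simp: in_keys_iff split: if_splits)
  thus ?thesis by (simp add: homogeneous_part_def)
qed

lemma homogeneous_part_sum:
  "homogeneous_part w D (sum f A) = (\<Sum>a\<in>A. homogeneous_part w D (f a))"
  by (rule poly_mapping_eqI) (simp add: lookup_homogeneous_part lookup_sum)

lemma homogeneous_part_single:
  "homogeneous_part w D (mconst c * mmonom \<alpha>) =
     (if weighted_degree w \<alpha> = D then mconst c * mmonom \<alpha> else 0)"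
  by (rule poly_mapping_eqI)
     (auto simp: lookup_homogeneous_part lookup_mconst_mult mmonom_def lookup_single when_def)

lemma homogeneous_part_mmonom: "homogeneous_part w (weighted_degree w \<alpha>) (mmonom \<alpha>) = mmonom \<alpha>"
  using homogeneous_part_single[of w "weighted_degree w \<alpha>" 1 \<alpha>] by simp

text \<open>Multiplication by \<open>q\<close> shifts degrees by \<open>e\<close>, so
  \<open>h'\<close> is the part of \<open>h\<close> of degree \<open>D - e\<close>. Writing the
  degree condition as a sum avoids truncated subtraction and makes \<open>h'\<close> zero when
  \<open>e > D\<close>.\<close>

lemma homogeneous_part_mult:
  assumes "weighted_homogeneous w e q"
  obtains h' where "homogeneous_part w D (h * q) = h' * q"
    "\<And>\<gamma>. \<gamma> \<in> Poly_Mapping.keys h' \<Longrightarrow> weighted_degree w \<gamma> + e = D"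
proof
  define h' where "h' = (\<Sum>\<gamma>\<in>Poly_Mapping.keys h. if weighted_degree w \<gamma> + e = D
      then mconst (Poly_Mapping.lookup h \<gamma>) * mmonom \<gamma> else 0)"
  let ?c = "\<lambda>p \<gamma>. mconst (Poly_Mapping.lookup p \<gamma>) * mmonom \<gamma>"
  have deg: "weighted_degree w \<beta> = e" if "\<beta> \<in> Poly_Mapping.keys q" for \<beta>
    using assms that by (simp add: weighted_homogeneous_def weighted_degree_def)
  have "h * q = (\<Sum>\<gamma>\<in>Poly_Mapping.keys h. \<Sum>\<beta>\<in>Poly_Mapping.keys q. ?c h \<gamma> * ?c q \<beta>)"
    by (simp only: flip: mpoly_expand sum_product)
  also have "\<dots> = (\<Sum>\<gamma>\<in>Poly_Mapping.keys h. \<Sum>\<beta>\<in>Poly_Mapping.keys q.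
      mconst (Poly_Mapping.lookup h \<gamma> * Poly_Mapping.lookup q \<beta>) * mmonom (\<gamma> + \<beta>))"
    by (intro sum.cong refl) (simp add: mconst_mult mmonom_add mult_ac)
  finally have "homogeneous_part w D (h * q) = (\<Sum>\<gamma>\<in>Poly_Mapping.keys h. \<Sum>\<beta>\<in>Poly_Mapping.keys q.
      if weighted_degree w \<gamma> + e = D then
      mconst (Poly_Mapping.lookup h \<gamma> * Poly_Mapping.lookup q \<beta>) * mmonom (\<gamma> + \<beta>) else 0)"
    using deg by (simp add: homogeneous_part_sum homogeneous_part_single weighted_degree_add cong: sum.cong)
  also have "\<dots> = (\<Sum>\<gamma>\<in>Poly_Mapping.keys h. \<Sum>\<beta>\<in>Poly_Mapping.keys q.
      (if weighted_degree w \<gamma> + e = D then ?c h \<gamma> else 0) * ?c q \<beta>)"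
    by (intro sum.cong refl) (simp add: mconst_mult mmonom_add mult_ac)
  also have "\<dots> = h' * q"
    unfolding h'_def by (simp only: flip: mpoly_expand sum_product)
  finally show "homogeneous_part w D (h * q) = h' * q" .
  show "weighted_degree w \<gamma> + e = D" if "\<gamma> \<in> Poly_Mapping.keys h'" for \<gamma>
  proof (rule ccontr)
    assume "weighted_degree w \<gamma> + e \<noteq> D"
    hence "Poly_Mapping.lookup h' \<gamma> = 0"
      by (auto simp: h'_def lookup_sum lookup_mconst_mult mmonom_def lookup_single when_def intro!: sum.neutral)
    thus False using that by (simp add: in_keys_iff)
  qed
qed

text \<open>Modulo the ideal every monomial outside the box vanishes, so by induction on the weighted
  degree the polynomial ring is a finitely generated module over the algebra generated by
  \<open>Q\<close>.\<close>

lemma mmonom_in_span_box_times_powers: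
  fixes Q :: "'n::finite mpoly set"
  assumes fin: "finite Q" and hom: "\<And>q. q \<in> Q \<Longrightarrow> weighted_homogeneous w (e q) q \<and> e q > 0"
    and nil: "\<And>i. mvar i ^ Suc K \<in> ideal.span Q"
  shows "mmonom \<alpha> \<in> mpoly.span ((\<lambda>(\<alpha>, \<beta>). mmonom \<alpha> * (\<Prod>q\<in>Q. q ^ \<beta> q)) `
           (exponent_box K \<times> PiE Q (\<lambda>_. {..weighted_degree w \<alpha>})))"
proof (induction "weighted_degree w \<alpha>" arbitrary: \<alpha> rule: less_induct)
  case less
  define M where "M D = (\<lambda>(\<alpha>, \<beta>). mmonom \<alpha> * (\<Prod>q\<in>Q. q ^ \<beta> q)) `
           (exponent_box K \<times> PiE Q (\<lambda>_. {..D::nat}))" for D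
  define D where "D = weighted_degree w \<alpha>"
  have IH: "mmonom \<gamma> \<in> mpoly.span (M (weighted_degree w \<gamma>))" if "weighted_degree w \<gamma> < D" for \<gamma>
    using less that by (simp add: M_def D_def)
  \<comment> \<open>Multiplication by \<open>q\<close> raises one exponent by one, which the strict
    inequality \<open>D' < D\<close> absorbs.\<close>
  have mult: "p * q \<in> mpoly.span (M D)" if p: "p \<in> mpoly.span (M D')" and q: "q \<in> Q" and "D' < D"
    for p q D'
    using p
  proof (induction rule: mpoly.span_induct_alt)
    case base thus ?case by (simp add: mpoly.span_zero)
  next
    case (step c x y)
    then obtain \<gamma> \<beta> where \<gamma>: "\<gamma> \<in> exponent_box K" "\<beta> \<in> PiE Q (\<lambda>_. {..D'})"
      and x: "x = mmonom \<gamma> * (\<Prod>q\<in>Q. q ^ \<beta> q)" by (auto simp: M_def)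
    define \<beta>' where "\<beta>' = \<beta>(q := Suc (\<beta> q))"
    have "\<beta>' \<in> PiE Q (\<lambda>_. {..D})"
      using \<gamma> q \<open>D' < D\<close> by (fastforce simp: \<beta>'_def PiE_iff extensional_def)
    moreover have "(\<Prod>p\<in>Q - {q}. p ^ \<beta>' p) = (\<Prod>p\<in>Q - {q}. p ^ \<beta> p)"
      by (rule prod.cong) (auto simp: \<beta>'_def)
    hence "(\<Prod>p\<in>Q. p ^ \<beta> p) * q = (\<Prod>p\<in>Q. p ^ \<beta>' p)"
      by (simp add: prod.remove[OF fin q] \<beta>'_def mult_ac)
    hence "x * q = mmonom \<gamma> * (\<Prod>q\<in>Q. q ^ \<beta>' q)" by (simp add: x mult.assoc)
    ultimately have "x * q \<in> M D" using \<gamma> by (auto simp: M_def)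
    hence "mconst c * (x * q) + y * q \<in> mpoly.span (M D)"
      by (intro mpoly.span_add[OF mpoly.span_scale[OF mpoly.span_base] step(2)])
    thus ?case by (simp add: distrib_right mult.assoc)
  qed
  have "mmonom \<alpha> \<in> mpoly.span (M D)"
  proof (cases "\<alpha> \<in> exponent_box K")
    case True
    have "mmonom \<alpha> * (\<Prod>q\<in>Q. q ^ (\<lambda>q\<in>Q. 0) q) \<in> M D"
      unfolding M_def using True by (intro image_eqI[where x = "(\<alpha>, \<lambda>q\<in>Q. 0)"]) auto
    thus ?thesis by (simp add: mpoly.span_base)
  next
    case False
    then obtain i where i: "Poly_Mapping.lookup \<alpha> i \<ge> Suc K"
      by (auto simp: exponent_box_def not_le Suc_le_eq)
    define \<alpha>' where "\<alpha>' = \<alpha> - Poly_Mapping.single i (Suc K)"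
    have "\<alpha> = \<alpha>' + Poly_Mapping.single i (Suc K)"
      using i by (intro poly_mapping_eqI) (auto simp: \<alpha>'_def lookup_add lookup_minus lookup_single when_def)
    hence "mmonom \<alpha> = mmonom \<alpha>' * mvar i ^ Suc K"
      by (simp only: mmonom_add mvar_power)
    hence "mmonom \<alpha> \<in> ideal.span Q" using nil ideal.span_scale by metis
    then obtain u where u: "mmonom \<alpha> = (\<Sum>q\<in>Q. u q * q)" by (auto simp: ideal.span_finite[OF fin])
    \<comment> \<open>Passing to the part of degree \<open>D\<close> makes the coefficient of
      \<open>q\<close> homogeneous of degree \<open>D - e q\<close>, which is below
      \<open>D\<close>, so the induction hypothesis applies to its monomials.\<close>
    have "mmonom \<alpha> = (\<Sum>q\<in>Q. homogeneous_part w D (u q * q))"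
      using arg_cong[OF u, of "homogeneous_part w D"]
      by (simp add: homogeneous_part_sum homogeneous_part_mmonom D_def)
    also have "\<dots> \<in> mpoly.span (M D)"
    proof (rule mpoly.span_sum)
      fix q assume q: "q \<in> Q"
      obtain h where h: "homogeneous_part w D (u q * q) = h * q"
        "\<And>\<gamma>. \<gamma> \<in> Poly_Mapping.keys h \<Longrightarrow> weighted_degree w \<gamma> + e q = D"
        using homogeneous_part_mult hom[OF q] by metis
      have "h * q = (\<Sum>\<gamma>\<in>Poly_Mapping.keys h. mconst (Poly_Mapping.lookup h \<gamma>) * (mmonom \<gamma> * q))"
        by (subst mpoly_expand[of h]) (simp add: sum_distrib_right mult.assoc)
      also have "\<dots> \<in> mpoly.span (M D)"
      proof (rule mpoly.span_sum, rule mpoly.span_scale)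
        fix \<gamma> assume "\<gamma> \<in> Poly_Mapping.keys h"
        hence "weighted_degree w \<gamma> < D" using h(2) hom[OF q] by fastforce
        thus "mmonom \<gamma> * q \<in> mpoly.span (M D)" using mult IH q by blast
      qed
      finally show "homogeneous_part w D (u q * q) \<in> mpoly.span (M D)" by (simp add: h)
    qed
    finally show ?thesis .
  qed
  thus ?case by (simp add: M_def D_def)
qed

text \<open>A comparison of growth rates: the box of size \<open>s\<close> contains
  \<open>Suc s ^ CARD('n)\<close> independent monomials, all in the span of a number of products
  that grows at most like \<open>Suc s ^ card Q\<close>.\<close>

lemma card_ge_if_zero_dimensional:
  fixes Q :: "'n::finite mpoly set"
  assumes fin: "finite Q" and hom: "\<And>q. q \<in> Q \<Longrightarrow> weighted_homogeneous w (e q) q \<and> e q > 0"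
    and nil: "\<And>i. mvar i ^ Suc K \<in> ideal.span Q"
  shows "CARD('n) \<le> card Q"
proof (rule ccontr)
  assume "\<not> ?thesis"
  hence less: "card Q < CARD('n)" by simp
  \<comment> \<open>A monomial with exponents at most \<open>s\<close> has weighted degree at most
    \<open>s * W\<close>; \<open>C\<close> collects the factors that do not depend on
    \<open>s\<close>.\<close>
  define W where "W = (\<Sum>i\<in>UNIV. w i)"
  define C where "C = Suc K ^ CARD('n) * Suc W ^ card Q"
  define M where "M D = (\<lambda>(\<alpha>, \<beta>). mmonom \<alpha> * (\<Prod>q\<in>Q. q ^ \<beta> q)) `
           ((exponent_box K :: ('n \<Rightarrow>\<^sub>0 nat) set) \<times> PiE Q (\<lambda>_. {..D::nat}))" for D
  have M_mono: "M D \<subseteq> M D'" if "D \<le> D'" for D D'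
    unfolding M_def using that by (intro image_mono Sigma_mono PiE_mono) auto
  have fin_prod: "finite ((exponent_box K :: ('n \<Rightarrow>\<^sub>0 nat) set) \<times> PiE Q (\<lambda>_. {..D::nat}))" for D
    using fin by (intro finite_cartesian_product finite_PiE finite_exponent_box) auto
  have card_M: "card (M D) \<le> Suc K ^ CARD('n) * Suc D ^ card Q" for D
  proof -
    have "card (M D) \<le> card ((exponent_box K :: ('n \<Rightarrow>\<^sub>0 nat) set) \<times> PiE Q (\<lambda>_. {..D::nat}))"
      unfolding M_def by (rule card_image_le[OF fin_prod])
    also have "\<dots> = Suc K ^ CARD('n) * Suc D ^ card Q"
      using fin by (simp add: card_cartesian_product card_PiE card_exponent_box)
    finally show ?thesis .
  qed
  have bound: "Suc s \<le> C" for s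
  proof -
    have sub: "mmonom ` exponent_box s \<subseteq> mpoly.span (M (s * W))"
    proof
      fix p :: "'n mpoly" assume "p \<in> mmonom ` exponent_box s"
      then obtain \<alpha> where \<alpha>: "\<alpha> \<in> exponent_box s" "p = mmonom \<alpha>" by blast
      have "weighted_degree w \<alpha> \<le> s * W"
        unfolding weighted_degree_def W_def sum_distrib_left
        using \<alpha> by (intro sum_mono mult_right_mono) (auto simp: exponent_box_def)
      hence "mpoly.span (M (weighted_degree w \<alpha>)) \<subseteq> mpoly.span (M (s * W))"
        by (intro mpoly.span_mono M_mono)
      thus "p \<in> mpoly.span (M (s * W))"
        using mmonom_in_span_box_times_powers[OF fin hom nil, of \<alpha>] \<alpha> by (auto simp: M_def)
    qed
    have "Suc s * Suc s ^ card Q = Suc s ^ Suc (card Q)" by simp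
    also have "\<dots> \<le> Suc s ^ CARD('n)"
      using less by (intro power_increasing) auto
    also have "\<dots> = card (mmonom ` (exponent_box s :: ('n \<Rightarrow>\<^sub>0 nat) set))"
      by (subst card_image[OF inj_on_subset[OF inj_mmonom]]) (auto simp: card_exponent_box)
    also have "\<dots> \<le> card (M (s * W))"
      using mpoly.independent_span_bound[OF _ independent_mmonom sub] fin_prod by (auto simp: M_def)
    also have "\<dots> \<le> Suc K ^ CARD('n) * Suc (s * W) ^ card Q" by (rule card_M)
    also have "\<dots> \<le> Suc K ^ CARD('n) * (Suc W * Suc s) ^ card Q"
      by (intro mult_left_mono power_mono) auto
    also have "\<dots> = C * Suc s ^ card Q" by (simp only: C_def power_mult_distrib mult.assoc)
    finally show ?thesis by (simp only: mult_le_cancel2 zero_less_power zero_less_Suc simp_thms)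
  qed
  from bound[of C] show False by simp
qed

text \<open>If there were no such zero, the Nullstellensatz would put a power of every variable in
  the ideal of \<open>Q\<close>, and that takes at least as many equations as variables.\<close>

theorem weighted_projective_intersection_nonempty:
  fixes Q :: "'n::finite mpoly set"
  assumes fin: "finite Q" and card: "card Q < CARD('n)"
    and hom: "\<And>q. q \<in> Q \<Longrightarrow> \<exists>e>0. weighted_homogeneous w e q"
  obtains x where "x \<noteq> 0" "\<And>q. q \<in> Q \<Longrightarrow> mpoly_eval q x = 0"
proof -
  obtain e where e: "\<And>q. q \<in> Q \<Longrightarrow> weighted_homogeneous w (e q) q \<and> e q > 0"
    using hom by metis
  have "\<exists>i. \<forall>k. mvar i ^ k \<notin> ideal.span Q"
  proof (rule ccontr)
    assume "\<not> ?thesis"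
    then obtain k where k: "\<And>i. mvar i ^ k i \<in> ideal.span Q" by metis
    define K where "K = (\<Sum>i\<in>UNIV. k i)"
    have "mvar i ^ Suc K \<in> ideal.span Q" for i
    proof -
      have "k i \<le> K" unfolding K_def by (rule member_le_sum) auto
      hence "mvar i ^ Suc K = mvar i ^ (Suc K - k i) * mvar i ^ k i" by (simp flip: power_add)
      thus ?thesis using ideal.span_scale[OF k[of i]] by simp
    qed
    hence "CARD('n) \<le> card Q" using card_ge_if_zero_dimensional[OF fin e] by blast
    thus False using card by simp
  qed
  then obtain i where i: "\<And>k. mvar i ^ k \<notin> ideal.span Q" by blast
  obtain x where x: "\<And>q. q \<in> Q \<Longrightarrow> mpoly_eval q x = 0" "x $ i \<noteq> 0"
    using nullstellensatz[OF i] by blast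
  hence "x \<noteq> 0" by auto
  thus thesis using that x by blast
qed

section \<open>The Jacobian and the isotropy groups\<close>

text \<open>Only the factor of the \<open>i\<close>-th variable depends on \<open>z\<close>, so the
  analytic derivative is the formal one. At exponent zero the truncated \<open>- 1\<close> is
  harmless because the coefficient is zero.\<close>

lemma jacobian_eq:
  "jacobian P x $ j $ i = (\<Sum>\<alpha>\<in>Poly_Mapping.keys (P j). Poly_Mapping.lookup (P j) \<alpha> *
     (of_nat (Poly_Mapping.lookup \<alpha> i) * (x $ i) ^ (Poly_Mapping.lookup \<alpha> i - 1) *
       (\<Prod>k\<in>UNIV - {i}. (x $ k) ^ Poly_Mapping.lookup \<alpha> k)))"
proof -
  have "mpoly_eval (P j) (x + axis i z) = (\<Sum>\<alpha>\<in>Poly_Mapping.keys (P j). Poly_Mapping.lookup (P j) \<alpha> *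
      ((x $ i + z) ^ Poly_Mapping.lookup \<alpha> i * (\<Prod>k\<in>UNIV - {i}. (x $ k) ^ Poly_Mapping.lookup \<alpha> k)))" for z
    unfolding mpoly_eval_def
  proof (rule sum.cong[OF refl])
    fix \<alpha>
    have "(\<Prod>k\<in>UNIV - {i}. ((x + axis i z) $ k) ^ Poly_Mapping.lookup \<alpha> k)
        = (\<Prod>k\<in>UNIV - {i}. (x $ k) ^ Poly_Mapping.lookup \<alpha> k)"
      by (rule prod.cong) (auto simp: axis_def)
    thus "Poly_Mapping.lookup (P j) \<alpha> * (\<Prod>k\<in>UNIV. ((x + axis i z) $ k) ^ Poly_Mapping.lookup \<alpha> k) =
      Poly_Mapping.lookup (P j) \<alpha> *
      ((x $ i + z) ^ Poly_Mapping.lookup \<alpha> i * (\<Prod>k\<in>UNIV - {i}. (x $ k) ^ Poly_Mapping.lookup \<alpha> k))"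
      by (simp add: prod.remove[of UNIV i])
  qed
  moreover have "((\<lambda>z. \<Sum>\<alpha>\<in>Poly_Mapping.keys (P j). Poly_Mapping.lookup (P j) \<alpha> *
      ((x $ i + z) ^ Poly_Mapping.lookup \<alpha> i * (\<Prod>k\<in>UNIV - {i}. (x $ k) ^ Poly_Mapping.lookup \<alpha> k)))
    has_field_derivative (\<Sum>\<alpha>\<in>Poly_Mapping.keys (P j). Poly_Mapping.lookup (P j) \<alpha> *
     (of_nat (Poly_Mapping.lookup \<alpha> i) * (x $ i) ^ (Poly_Mapping.lookup \<alpha> i - 1) *
       (\<Prod>k\<in>UNIV - {i}. (x $ k) ^ Poly_Mapping.lookup \<alpha> k)))) (at 0)"
    by (rule DERIV_sum, rule DERIV_cmult, rule DERIV_cmult_right) (auto intro!: derivative_eq_intros)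
  ultimately show ?thesis by (simp add: jacobian_def DERIV_imp_deriv)
qed

text \<open>Euler's identity: the weighted sum of the partial derivatives multiplies a monomial by
  its weighted degree. At points of the cone it makes the Euler vector tangent.\<close>

lemma jacobian_euler_vector:
  assumes "weighted_homogeneous w e (P j)"
  shows "(jacobian P x *v euler_vector w x) $ j = of_nat e * mpoly_eval (P j) x"
proof -
  have monomial: "of_nat a * (x $ i) ^ (a - 1) * p * (c * x $ i) = of_nat a * c * ((x $ i) ^ a * p)" for a c p i
    by (cases a) auto
  have "(jacobian P x *v euler_vector w x) $ j = (\<Sum>i\<in>UNIV. \<Sum>\<alpha>\<in>Poly_Mapping.keys (P j).
      Poly_Mapping.lookup (P j) \<alpha> * (of_nat (Poly_Mapping.lookup \<alpha> i) * of_nat (w i) *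
       (\<Prod>k\<in>UNIV. (x $ k) ^ Poly_Mapping.lookup \<alpha> k)))"
    unfolding matrix_vector_mult_def jacobian_eq euler_vector_def sum_distrib_right vec_lambda_beta
  proof (intro sum.cong refl)
    fix i \<alpha>
    show "Poly_Mapping.lookup (P j) \<alpha> *
        (of_nat (Poly_Mapping.lookup \<alpha> i) * x $ i ^ (Poly_Mapping.lookup \<alpha> i - 1) *
         (\<Prod>k\<in>UNIV - {i}. x $ k ^ Poly_Mapping.lookup \<alpha> k)) * (of_nat (w i) * x $ i) =
      Poly_Mapping.lookup (P j) \<alpha> * (of_nat (Poly_Mapping.lookup \<alpha> i) * of_nat (w i) *
       (\<Prod>k\<in>UNIV. x $ k ^ Poly_Mapping.lookup \<alpha> k))"
      unfolding prod.remove[of UNIV i, OF finite UNIV_I] mult.assoc[of "Poly_Mapping.lookup (P j) \<alpha>"] monomial ..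
  qed
  also have "\<dots> = (\<Sum>\<alpha>\<in>Poly_Mapping.keys (P j). Poly_Mapping.lookup (P j) \<alpha> *
      (of_nat (\<Sum>i\<in>UNIV. Poly_Mapping.lookup \<alpha> i * w i) * (\<Prod>k\<in>UNIV. (x $ k) ^ Poly_Mapping.lookup \<alpha> k)))"
    by (subst sum.swap) (simp add: sum_distrib_left sum_distrib_right)
  also have "\<dots> = of_nat e * mpoly_eval (P j) x"
    using assms unfolding weighted_homogeneous_def mpoly_eval_def sum_distrib_left
    by (intro sum.cong) auto
  finally show ?thesis .
qed

text \<open>A monomial that contributes to this derivative at \<open>x\<close>, once divided by the
  \<open>i\<close>-th variable, involves only variables that are non-zero at \<open>x\<close>. Their
  weights are multiples of \<open>r\<close>, and the remaining degree is
  \<open>e - w i\<close>.\<close>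

lemma jacobian_nonzero_imp_dvd:
  assumes hom: "weighted_homogeneous w e (P j)" and r: "\<And>k. x $ k \<noteq> 0 \<Longrightarrow> r dvd w k"
    and nz: "jacobian P x $ j $ i \<noteq> 0"
  shows "int r dvd int e - int (w i)"
proof -
  obtain \<alpha> where \<alpha>: "\<alpha> \<in> Poly_Mapping.keys (P j)"
    and ai: "Poly_Mapping.lookup \<alpha> i \<noteq> 0" "(x $ i) ^ (Poly_Mapping.lookup \<alpha> i - 1) \<noteq> 0"
    and ak: "(\<Prod>k\<in>UNIV - {i}. (x $ k) ^ Poly_Mapping.lookup \<alpha> k) \<noteq> 0"
    using nz unfolding jacobian_eq by (elim sum.not_neutral_contains_not_neutral) auto
  have "int e - int (w i) = (int (Poly_Mapping.lookup \<alpha> i) - 1) * int (w i)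
      + (\<Sum>k\<in>UNIV - {i}. int (Poly_Mapping.lookup \<alpha> k) * int (w k))"
  proof -
    have "(\<Sum>k\<in>UNIV. Poly_Mapping.lookup \<alpha> k * w k) = e"
      using hom \<alpha> by (simp add: weighted_homogeneous_def)
    hence "int e = (\<Sum>k\<in>UNIV. int (Poly_Mapping.lookup \<alpha> k) * int (w k))" by auto
    thus ?thesis by (simp add: sum.remove[of UNIV i] algebra_simps)
  qed
  moreover have "int r dvd (int (Poly_Mapping.lookup \<alpha> i) - 1) * int (w i)"
  proof (cases "x $ i = 0")
    case True
    hence "Poly_Mapping.lookup \<alpha> i = 1" using ai by (simp add: power_0_left split: if_splits)
    thus ?thesis by simp
  qed (use r in auto)
  moreover have "int r dvd int (Poly_Mapping.lookup \<alpha> k) * int (w k)" if "k \<in> UNIV - {i}" for k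
  proof (cases "x $ k = 0")
    case True
    hence "Poly_Mapping.lookup \<alpha> k = 0" using ak that by (auto simp: power_0_left split: if_splits)
    thus ?thesis by simp
  qed (use r in auto)
  ultimately show ?thesis by (auto intro!: dvd_add dvd_sum)
qed

section \<open>Roots of unity and the isotropy group of a point\<close>

definition root_of_unity :: "nat \<Rightarrow> complex" where
  "root_of_unity r = exp (2 * of_real pi * \<i> / of_nat r)"

lemma root_of_unity_pow_eq_1: "r > 0 \<Longrightarrow> root_of_unity r ^ n = 1 \<longleftrightarrow> r dvd n"
  using complex_root_unity_eq_1[of r n] by (simp add: root_of_unity_def exp_of_nat_mult[symmetric] mult_ac)

lemma root_of_unity_neq_0 [simp]: "root_of_unity r \<noteq> 0"
  by (simp add: root_of_unity_def)

lemma powi_eq_1_iff_pow: "(t::complex) powi (- int n) = 1 \<longleftrightarrow> t ^ n = 1"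
  by (simp add: power_int_minus power_int_of_nat)

lemma powi_eq_powi_if_dvd:
  assumes "(t::complex) ^ r = 1" "t \<noteq> 0" "int r dvd a - b"
  shows "t powi a = t powi b"
proof -
  obtain q where "a = b + int r * q" using assms(3) by (metis add.commute diff_add_cancel dvd_def)
  thus ?thesis using assms by (simp add: power_int_add power_int_mult power_int_of_nat)
qed

lemma root_of_unity_powi_eq:
  assumes "r > 0" "root_of_unity r powi a = root_of_unity r powi b"
  shows "int r dvd a - b"
proof -
  have 1: "root_of_unity r powi (a - b) = 1" using assms(2) by (simp add: power_int_diff)
  have "root_of_unity r ^ nat \<bar>a - b\<bar> = 1"
  proof (cases "a \<ge> b")
    case True thus ?thesis using 1 by (simp add: power_int_def)
  next
    case False
    hence "root_of_unity r powi (- int (nat \<bar>a - b\<bar>)) = 1" using 1 by simp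
    thus ?thesis by (simp only: powi_eq_1_iff_pow)
  qed
  hence "r dvd nat \<bar>a - b\<bar>" using assms root_of_unity_pow_eq_1 by blast
  hence "int r dvd \<bar>a - b\<bar>" by (metis int_dvd_int_iff int_nat_eq abs_ge_zero)
  thus ?thesis by simp
qed

lemma mem_isotropy_group_iff:
  "t \<in> isotropy_group w x \<longleftrightarrow> t \<noteq> 0 \<and> (\<forall>k. x $ k \<noteq> 0 \<longrightarrow> t ^ w k = 1)"
proof -
  have "t powi (- int (w k)) * x $ k = x $ k \<longleftrightarrow> (x $ k \<noteq> 0 \<longrightarrow> t ^ w k = 1)" for k
    using powi_eq_1_iff_pow[of t "w k"] by auto
  thus ?thesis by (simp add: isotropy_group_def wact_def vec_eq_iff)
qed

text \<open>A primitive \<open>r\<close>-th root of unity fixes \<open>x\<close>, so it acts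
  trivially on each non-zero coordinate.\<close>

lemma dvd_weight_if_isotropy:
  assumes "r > 0" "isotropy_group w x = {t. t ^ r = 1}" "x $ k \<noteq> 0"
  shows "r dvd w k"
proof -
  have "root_of_unity r \<in> isotropy_group w x" using assms root_of_unity_pow_eq_1[of r r] by simp
  hence "root_of_unity r ^ w k = 1" using assms(3) unfolding mem_isotropy_group_iff by blast
  thus ?thesis using assms(1) by (simp add: root_of_unity_pow_eq_1)
qed

lemma pow_gcd_eq_1:
  assumes "(t::complex) ^ a = 1" "t ^ b = 1" shows "t ^ gcd a b = 1"
proof (cases "a = 0")
  case False
  then obtain x y where "a * x = b * y + gcd a b" using bezout_nat by blast
  hence "t ^ (b * y + gcd a b) = t ^ (a * x)" by simp
  thus ?thesis using assms by (simp add: power_add power_mult)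
qed (use assms in auto)

text \<open>The order is the gcd of the weights of the non-zero coordinates, since by Bezout the
  exponents that kill \<open>t\<close> are closed under gcd.\<close>

lemma isotropy_group_eq:
  fixes x :: "complex ^ 'n::finite"
  assumes "\<And>k. w k > 0" "x \<noteq> 0"
  obtains r where "r > 0" "isotropy_group w x = {t. t ^ r = 1}"
proof
  define r where "r = Gcd (w ` {k. x $ k \<noteq> 0})"
  obtain k where k: "x $ k \<noteq> 0" using assms(2) by (auto simp: vec_eq_iff)
  show "r > 0" using k assms(1)[of k] by (fastforce simp: r_def intro!: Nat.gr0I)
  have Gcd: "t ^ Gcd (w ` A) = 1" if "\<And>k. k \<in> A \<Longrightarrow> t ^ w k = 1" for t :: complex and A :: "'n set"
    using finite[of A] that by (induction A rule: finite_induct) (auto intro: pow_gcd_eq_1)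
  show "isotropy_group w x = {t. t ^ r = 1}"
  proof (intro set_eqI iffI)
    fix t assume "t \<in> isotropy_group w x"
    hence "t ^ Gcd (w ` {k. x $ k \<noteq> 0}) = 1" by (intro Gcd) (simp add: mem_isotropy_group_iff)
    thus "t \<in> {t. t ^ r = 1}" by (simp add: r_def)
  next
    fix t :: complex assume t: "t \<in> {t. t ^ r = 1}"
    have "t ^ w k = 1" if "x $ k \<noteq> 0" for k
    proof -
      have "r dvd w k" using that by (simp add: r_def)
      then obtain q where "w k = r * q" by (elim dvdE)
      thus ?thesis using t by (simp add: power_mult)
    qed
    moreover have "t \<noteq> 0" using t \<open>r > 0\<close> by (auto simp: power_0_left)
    ultimately show "t \<in> isotropy_group w x" by (simp add: mem_isotropy_group_iff)
  qed
qed

section \<open>Homogeneous vectors\<close>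

text \<open>The eigenvectors of the \<open>r\<close>-th roots of unity for the character
  \<open>c\<close>, described by their support because the action is diagonal.\<close>

definition homogeneous_vector :: "('n::finite \<Rightarrow> nat) \<Rightarrow> nat \<Rightarrow> int \<Rightarrow> complex ^ 'n \<Rightarrow> bool" where
  "homogeneous_vector w r c v \<longleftrightarrow> (\<forall>i. v $ i \<noteq> 0 \<longrightarrow> int r dvd c + int (w i))"

lemma wact_homogeneous_vector:
  assumes "homogeneous_vector w r c v" "t ^ r = 1" "t \<noteq> 0"
  shows "wact w t v = t powi c *s v"
proof -
  have "t powi (- int (w i)) * v $ i = t powi c * v $ i" for i
  proof (cases "v $ i = 0")
    case False
    hence "int r dvd c - (- int (w i))" using assms(1) by (simp add: homogeneous_vector_def)
    hence "t powi c = t powi (- int (w i))" by (rule powi_eq_powi_if_dvd[OF assms(2,3)])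
    thus ?thesis by simp
  qed simp
  thus ?thesis by (simp add: wact_def vec_eq_iff)
qed

text \<open>The projection to the eigenspace of the character \<open>c\<close>.\<close>

definition vector_component :: "('n::finite \<Rightarrow> nat) \<Rightarrow> nat \<Rightarrow> int \<Rightarrow> complex ^ 'n \<Rightarrow> complex ^ 'n" where
  "vector_component w r c v = (\<chi> i. if int r dvd c + int (w i) then v $ i else 0)"

lemma homogeneous_vector_component: "homogeneous_vector w r c (vector_component w r c v)"
  by (auto simp: homogeneous_vector_def vector_component_def)

lemma sum_vector_component:
  assumes "r > 0"
  shows "(\<Sum>c\<in>{0..<int r}. vector_component w r c v) = v"
proof -
  have "(\<Sum>c\<in>{0..<int r}. if int r dvd c + int (w i) then v $ i else 0) = v $ i" for i
  proof -
    have "int r dvd c + int (w i) \<longleftrightarrow> c = (- int (w i)) mod int r" if "c \<in> {0..<int r}" for c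
    proof -
      have "int r dvd c + int (w i) \<longleftrightarrow> c mod int r = (- int (w i)) mod int r"
        by (simp add: mod_eq_dvd_iff)
      thus ?thesis using that by simp
    qed
    hence "(\<Sum>c\<in>{0..<int r}. if int r dvd c + int (w i) then v $ i else 0)
        = (\<Sum>c\<in>{0..<int r}. if c = (- int (w i)) mod int r then v $ i else 0)"
      by (intro sum.cong) auto
    also have "\<dots> = v $ i" using assms by simp
    finally show ?thesis .
  qed
  thus ?thesis by (simp add: vec_eq_iff vector_component_def)
qed

text \<open>A homogeneous vector of class \<open>c\<close> spans a copy of the character \<open>c\<close>; the coordinate
  axis \<open>i\<close> has class \<open>- w i\<close>. A homogeneous basis has the same classes as the coordinate basis.\<close>

lemma sum_over_homogeneous_basis:
  fixes b :: "'k \<Rightarrow> complex ^ 'n::finite" and \<phi> :: "int \<Rightarrow> real"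
  assumes r: "r > 0" and fin: "finite K" and card: "card K \<ge> CARD('n)"
    and hom: "\<And>k. k \<in> K \<Longrightarrow> homogeneous_vector w r (cl k) (b k)"
    and indep: "\<And>u k. (\<Sum>k\<in>K. u k *s b k) = 0 \<Longrightarrow> k \<in> K \<Longrightarrow> u k = 0"
    and \<phi>: "\<And>c c'. int r dvd c - c' \<Longrightarrow> \<phi> c = \<phi> c'"
  shows "(\<Sum>k\<in>K. \<phi> (cl k)) = (\<Sum>i\<in>UNIV. \<phi> (- int (w i)))"
proof -
  define R where "R = {0..<int r}"
  define Kc where "Kc c = {k \<in> K. cl k mod int r = c}" for c
  define Sc where "Sc c = {i. (- int (w i)) mod int r = c}" for c
  \<comment> \<open>The basis vectors of class \<open>c\<close> are independent and lie in the span
    of the axes of class \<open>c\<close>.\<close>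
  have le: "card (Kc c) \<le> card (Sc c)" for c
  proof -
    have inj: "inj_on b (Kc c)"
    proof (rule inj_onI, rule ccontr)
      fix k l assume kl: "k \<in> Kc c" "l \<in> Kc c" "b k = b l" "k \<noteq> l"
      define u where "u = (\<lambda>x. if x = k then 1 else if x = l then - 1 else 0 :: complex)"
      have "(\<Sum>x\<in>K. u x *s b x) = (\<Sum>x\<in>{k, l}. u x *s b x)"
        using kl fin by (intro sum.mono_neutral_right) (auto simp: u_def Kc_def)
      also have "\<dots> = 0" using kl by (simp add: u_def)
      finally have "u k = 0" using indep[of u k] kl by (simp add: Kc_def)
      thus False by (simp add: u_def)
    qed
    have "vec.independent (b ` Kc c)"
    proof (rule vec.independent_if_scalars_zero)
      show "finite (b ` Kc c)" using fin by (simp add: Kc_def)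
      fix f x assume 0: "(\<Sum>x\<in>b ` Kc c. f x *s x) = 0" and "x \<in> b ` Kc c"
      then obtain k where k: "k \<in> Kc c" "x = b k" by blast
      define u where "u k = (if k \<in> Kc c then f (b k) else 0)" for k
      have "(\<Sum>k\<in>K. u k *s b k) = (\<Sum>k\<in>Kc c. f (b k) *s b k)"
        using fin by (intro sum.mono_neutral_cong_right) (auto simp: u_def Kc_def)
      also have "\<dots> = 0" using 0 by (simp add: sum.reindex[OF inj])
      finally have "u k = 0" using indep[of u k] k by (simp add: Kc_def)
      thus "f x = 0" using k by (simp add: u_def)
    qed
    moreover have "b ` Kc c \<subseteq> vec.span ((\<lambda>i. axis i 1) ` Sc c)"
    proof
      fix x assume "x \<in> b ` Kc c"
      then obtain k where k: "k \<in> K" "cl k mod int r = c" "x = b k" by (auto simp: Kc_def)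
      have Sc: "i \<in> Sc c" if "x $ i \<noteq> 0" for i
      proof -
        have "int r dvd cl k + int (w i)"
          using hom[OF k(1)] that k(3) by (simp add: homogeneous_vector_def)
        moreover have "- int (w i) - cl k = - (cl k + int (w i))" by simp
        ultimately have "int r dvd - int (w i) - cl k" by (simp only: dvd_minus_iff)
        hence "(- int (w i)) mod int r = cl k mod int r" by (simp only: mod_eq_dvd_iff)
        thus ?thesis using k by (simp add: Sc_def)
      qed
      have "x = (\<Sum>i\<in>UNIV. x $ i *s axis i 1)" by (simp add: basis_expansion)
      also have "\<dots> = (\<Sum>i\<in>Sc c. x $ i *s axis i 1)"
        using Sc by (intro sum.mono_neutral_right) auto
      also have "\<dots> \<in> vec.span ((\<lambda>i. axis i 1) ` Sc c)"
        by (intro vec.span_sum vec.span_scale vec.span_base) auto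
      finally show "x \<in> vec.span ((\<lambda>i. axis i 1) ` Sc c)" .
    qed
    ultimately have "card (b ` Kc c) \<le> card ((\<lambda>i. axis i 1 :: complex ^ 'n) ` Sc c)"
      using vec.independent_span_bound[of "(\<lambda>i. axis i 1) ` Sc c" "b ` Kc c"] by simp
    also have "\<dots> \<le> card (Sc c)" by (rule card_image_le) simp
    finally show ?thesis by (simp add: card_image[OF inj])
  qed
  have mod_R: "c mod int r \<in> R" for c using r by (simp add: R_def)
  have finR: "finite R" by (simp add: R_def)
  have cardK: "card K = (\<Sum>c\<in>R. card (Kc c))"
    using sum.group[OF fin finR, where g = "\<lambda>k. cl k mod int r" and h = "\<lambda>_. 1::nat"] mod_R by (auto simp: Kc_def image_subset_iff)
  have cardS: "CARD('n) = (\<Sum>c\<in>R. card (Sc c))"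
    using sum.group[OF finite[of UNIV] finR, where g = "\<lambda>i. (- int (w i)) mod int r" and h = "\<lambda>_. 1::nat"] mod_R
    by (auto simp: Sc_def image_subset_iff)
  \<comment> \<open>Summed over all classes the smaller sides already reach \<open>CARD('n)\<close>,
    so no inequality is strict.\<close>
  have eq: "card (Kc c) = card (Sc c)" if "c \<in> R" for c
  proof (rule ccontr)
    assume "card (Kc c) \<noteq> card (Sc c)"
    hence "card (Kc c) < card (Sc c)" using le[of c] by simp
    hence "(\<Sum>c\<in>R. card (Kc c)) < (\<Sum>c\<in>R. card (Sc c))"
      using le that finR by (intro sum_strict_mono_ex1) auto
    thus False using card cardK cardS by simp
  qed
  have \<phi>_mod: "\<phi> (c mod int r) = \<phi> c" for c
    by (rule \<phi>) (simp add: mod_eq_dvd_iff[symmetric])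
  have "(\<Sum>k\<in>K. \<phi> (cl k)) = (\<Sum>c\<in>R. \<Sum>k\<in>Kc c. \<phi> (cl k))"
    unfolding Kc_def using fin finR mod_R by (intro sum.group[symmetric]) auto
  also have "\<dots> = (\<Sum>c\<in>R. card (Kc c) * \<phi> c)"
    by (intro sum.cong refl) (simp add: Kc_def flip: \<phi>_mod[of "cl k" for k])
  also have "\<dots> = (\<Sum>c\<in>R. card (Sc c) * \<phi> c)" using eq by simp
  also have "\<dots> = (\<Sum>c\<in>R. \<Sum>i\<in>Sc c. \<phi> (- int (w i)))"
    by (intro sum.cong refl) (simp add: Sc_def flip: \<phi>_mod[of "- int (w i)" for i])
  also have "\<dots> = (\<Sum>i\<in>UNIV. \<phi> (- int (w i)))"
    using sum.group[OF finite[of UNIV] finR, where g = "\<lambda>i. (- int (w i)) mod int r"] mod_R by (simp add: Sc_def image_subset_iff)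
  finally show ?thesis .
qed

text \<open>Full row rank makes the rows distinct and independent, which yields a right
  inverse.\<close>

lemma surj_if_rank_eq:
  fixes A :: "complex ^ 'n::finite ^ 'm::finite"
  assumes "rank A = CARD('m)"
  shows "surj ((*v) A)"
proof -
  have dim: "vec.dim (rows A) = CARD('m)" using assms by (simp add: row_rank_def_gen)
  have rows: "rows A = range (\<lambda>i. row i A)" by (auto simp: rows_def)
  have "vec.dim (rows A) \<le> card (rows A)"
    by (rule vec.dim_le_card) (auto simp: rows intro: vec.span_base)
  moreover have "card (rows A) \<le> CARD('m)" unfolding rows by (rule card_image_le) simp
  ultimately have card: "card (rows A) = CARD('m)" using dim by simp
  hence inj: "inj (\<lambda>i. row i A)" unfolding rows by (rule eq_card_imp_inj_on[rotated]) simp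
  have ind: "vec.independent (rows A)"
    using vec.card_le_dim_spanning[of "rows A" "rows A"] card dim rows by (auto intro: vec.span_base)
  have "\<forall>c. (\<Sum>i\<in>UNIV. c i *s row i A) = 0 \<longrightarrow> (\<forall>i. c i = 0)"
  proof (intro allI impI)
    fix c i assume 0: "(\<Sum>i\<in>UNIV. c i *s row i A) = 0"
    have "(\<Sum>v\<in>rows A. c (inv (\<lambda>i. row i A) v) *s v) = (\<Sum>i\<in>UNIV. c i *s row i A)"
      unfolding rows by (subst sum.reindex[OF inj]) (simp add: inv_f_f[OF inj])
    hence "c (inv (\<lambda>i. row i A) (row i A)) = 0"
      using 0 vec.independentD[OF ind, of "rows A" "\<lambda>v. c (inv (\<lambda>i. row i A) v)" "row i A"] rows by auto
    thus "c i = 0" by (simp add: inv_f_f[OF inj])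
  qed
  then obtain B where "A ** B = mat 1" by (auto simp flip: matrix_right_invertible_independent_rows)
  hence "A *v (B *v y) = y" for y by (simp add: matrix_vector_mul_assoc)
  thus ?thesis by (metis surjI)
qed

section \<open>Local weights\<close>

text \<open>Equivariance of the Jacobian: a non-zero entry links only a coordinate and an equation
  with \<open>w i\<close> and \<open>e\<close> congruent modulo \<open>r\<close>, so projections on
  both sides correspond.\<close>

lemma jacobian_vector_component:
  assumes hom: "weighted_homogeneous w e (P j)" and r: "\<And>k. x $ k \<noteq> 0 \<Longrightarrow> r dvd w k"
  shows "(jacobian P x *v vector_component w r c v) $ j =
           (if int r dvd c + int e then (jacobian P x *v v) $ j else 0)"
proof -
  have "jacobian P x $ j $ i * vector_component w r c v $ i =
      (if int r dvd c + int e then jacobian P x $ j $ i * v $ i else 0)" for i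
  proof (cases "jacobian P x $ j $ i = 0")
    case False
    hence "int r dvd int e - int (w i)" using jacobian_nonzero_imp_dvd[where P = P and j = j, OF hom] r by blast
    moreover have "c + int e = (c + int (w i)) + (int e - int (w i))" by simp
    ultimately have "int r dvd c + int e \<longleftrightarrow> int r dvd c + int (w i)"
      by (metis dvd_add_left_iff)
    thus ?thesis by (simp add: vector_component_def)
  qed simp
  thus ?thesis by (simp add: matrix_vector_mult_def)
qed

lemma euler_vector_nth: "euler_vector w x $ i = of_nat (w i) * x $ i"
  by (simp add: euler_vector_def)

lemma homogeneous_euler_vector:
  assumes "\<And>k. x $ k \<noteq> 0 \<Longrightarrow> r dvd w k"
  shows "homogeneous_vector w r 0 (euler_vector w x)"
  using assms by (auto simp: homogeneous_vector_def euler_vector_nth)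

lemma subspace_cone_tangent_space: "vec.subspace (cone_tangent_space P x)"
  by (auto simp: vec.subspace_def cone_tangent_space_def matrix_vector_right_distrib
      matrix_vector_mult_scaleR vec.scale)

text \<open>An eigenvector modulo the Euler vector becomes a genuine eigenvector after subtracting a
  multiple of it: the two eigenvalues differ unless the weight is divisible by \<open>r\<close>, and in that case
  comparing coordinates on the support of \<open>x\<close> shows that the vector was an eigenvector already.\<close>

lemma homogeneous_lift:
  assumes r: "r > 0" and iso: "isotropy_group w x = {t. t ^ r = 1}"
    and w: "\<And>k. w k > 0" and x: "x \<noteq> 0"
    and v: "\<And>t. t \<in> isotropy_group w x \<Longrightarrow> wact w t v - t powi a *s v \<in> vec.span {euler_vector w x}"
  obtains \<mu> where "homogeneous_vector w r a (v - \<mu> *s euler_vector w x)"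
proof -
  define \<zeta> where "\<zeta> = root_of_unity r"
  have \<zeta>: "\<zeta> \<in> isotropy_group w x" using root_of_unity_pow_eq_1[OF r, of r] iso by (simp add: \<zeta>_def)
  obtain l where "wact w \<zeta> v - \<zeta> powi a *s v = l *s euler_vector w x"
    using v[OF \<zeta>] by (auto simp: vec.span_singleton)
  hence l: "\<zeta> powi (- int (w k)) * v $ k - \<zeta> powi a * v $ k = l * (of_nat (w k) * x $ k)" for k
    by (auto simp: vec_eq_iff wact_def euler_vector_nth)
  have supp: "r dvd w k" "\<zeta> powi (- int (w k)) = 1" if "x $ k \<noteq> 0" for k
    using \<zeta> that dvd_weight_if_isotropy[OF r iso that]
    by (auto simp: mem_isotropy_group_iff powi_eq_1_iff_pow)
  \<comment> \<open>Off the support of \<open>x\<close> the Euler vector vanishes, so the eigenvalue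
    equation holds exactly.\<close>
  have off: "int r dvd a + int (w k)" if "x $ k = 0" "v $ k \<noteq> 0" for k
  proof -
    have "\<zeta> powi a = \<zeta> powi (- int (w k))" using l[of k] that by simp
    thus ?thesis using root_of_unity_powi_eq[OF r, of a "- int (w k)"] by (simp add: \<zeta>_def)
  qed
  show thesis
  proof (cases "int r dvd a")
    case True
    show thesis
    proof (rule that[of 0])
      show "homogeneous_vector w r a (v - 0 *s euler_vector w x)"
        unfolding homogeneous_vector_def
      proof (intro allI impI)
        fix i assume "(v - 0 *s euler_vector w x) $ i \<noteq> 0"
        thus "int r dvd a + int (w i)"
          using off[of i] supp(1)[of i] True by (cases "x $ i = 0") (auto intro: dvd_add)
      qed
    qed
  next
    case False
    have ne: "\<zeta> powi a \<noteq> 1"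
      using False root_of_unity_powi_eq[OF r, of a 0] by (auto simp: \<zeta>_def)
    define \<mu> where "\<mu> = l / (1 - \<zeta> powi a)"
    \<comment> \<open>On the support of \<open>x\<close> the isotropy acts trivially, so the
      equation determines \<open>v $ k\<close>.\<close>
    have *: "v $ k = \<mu> * (of_nat (w k) * x $ k)" if "x $ k \<noteq> 0" for k
      using l[of k] supp(2)[OF that] ne by (simp add: \<mu>_def field_simps)
    have "homogeneous_vector w r a (v - \<mu> *s euler_vector w x)"
      unfolding homogeneous_vector_def
    proof (intro allI impI)
      fix i assume "(v - \<mu> *s euler_vector w x) $ i \<noteq> 0"
      thus "int r dvd a + int (w i)"
        using off[of i] * [of i] by (cases "x $ i = 0") (auto simp: euler_vector_nth)
    qed
    thus thesis by (rule that)
  qed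
qed

lemma independent_list_coeffs:
  assumes "vec.independent (set L)" "distinct L" "(\<Sum>i<length L. c i *s L ! i) = 0" "i < length L"
  shows "c i = 0"
proof -
  define idx where "idx = the_inv_into {..<length L} ((!) L)"
  have inj: "inj_on ((!) L) {..<length L}" using assms(2) by (simp add: inj_on_nth)
  have set: "set L = (!) L ` {..<length L}" by (auto simp: set_conv_nth)
  have idx: "idx (L ! i) = i" if "i < length L" for i
    using that inj by (simp add: idx_def the_inv_into_f_f)
  have "(\<Sum>v\<in>set L. c (idx v) *s v) = (\<Sum>i<length L. c i *s L ! i)"
    unfolding set by (subst sum.reindex[OF inj]) (simp add: idx)
  hence "c (idx (L ! i)) = 0"
    using assms(3) vec.independentD[OF assms(1), of "set L" "\<lambda>v. c (idx v)" "L ! i"] assms(4) by simp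
  thus ?thesis using idx assms(4) by simp
qed

text \<open>Any preimage can be projected to the class \<open>- d j\<close>: the projection is
  compatible with the Jacobian and fixes the target axis, which has that class.\<close>

lemma homogeneous_preimage_axis:
  fixes w :: "'n::finite \<Rightarrow> nat" and d :: "'m::finite \<Rightarrow> nat"
  assumes qs: "quasismooth_complete_intersection w d P" and x: "x \<in> affine_cone P - {0}"
    and r: "\<And>k. x $ k \<noteq> 0 \<Longrightarrow> r dvd w k"
  obtains u where "jacobian P x *v u = axis j 1" "homogeneous_vector w r (- int (d j)) u"
proof -
  have hom: "\<And>j. weighted_homogeneous w (d j) (P j)"
    and "rank (jacobian P x) = CARD('m)"
    using qs x by (auto simp: quasismooth_complete_intersection_def)
  then obtain y where y: "jacobian P x *v y = axis j 1"
    using surj_if_rank_eq by (metis surjD)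
  have "jacobian P x *v vector_component w r (- int (d j)) y = axis j 1"
    unfolding vec_eq_iff
  proof
    fix j'
    show "(jacobian P x *v vector_component w r (- int (d j)) y) $ j' = axis j 1 $ j'"
      using jacobian_vector_component[where P = P and j = j' and e = "d j'" and c = "- int (d j)" and v = y,
          OF hom r] y by (cases "j' = j") (auto simp: axis_def)
  qed
  thus thesis using that homogeneous_vector_component by blast
qed

text \<open>The Euler vector, homogeneous lifts of the tangent directions and homogeneous preimages
  of the target axes form a homogeneous basis, which is compared with the coordinate basis. Allowing
  every \<open>r\<close>-periodic \<open>\<phi>\<close> expresses equality of multisets modulo
  \<open>r\<close>; fractional parts and indicators of integrality are the instances used
  later.\<close>

theorem sum_over_local_weights:
  fixes \<phi> :: "int \<Rightarrow> real" and w :: "'n::finite \<Rightarrow> nat" and d :: "'m::finite \<Rightarrow> nat"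
  assumes qs: "quasismooth_complete_intersection w d P" and x: "x \<in> affine_cone P - {0}"
    and type: "local_quotient_type w P x r a"
    and \<phi>: "\<And>c c'. int r dvd c - c' \<Longrightarrow> \<phi> c = \<phi> c'"
  shows "(\<Sum>i\<in>UNIV. \<phi> (- int (w i))) =
           \<phi> 0 + (\<Sum>i<length a. \<phi> (a ! i)) + (\<Sum>j\<in>UNIV. \<phi> (- int (d j)))"
proof -
  let ?e = "euler_vector w x" and ?J = "jacobian P x"
  obtain v where r: "r > 0" and iso: "isotropy_group w x = {t. t ^ r = 1}"
    and len: "length v = length a" and dist: "distinct (?e # v)"
    and ind: "vec.independent (set (?e # v))"
    and span: "vec.span (set (?e # v)) = cone_tangent_space P x"
    and act: "\<And>i t. i < length a \<Longrightarrow> t \<in> isotropy_group w x \<Longrightarrow>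
             wact w t (v ! i) - t powi (a ! i) *s v ! i \<in> vec.span {?e}"
    using type unfolding local_quotient_type_def by blast
  have w: "\<And>k. w k > 0" using qs by (simp add: quasismooth_complete_intersection_def)
  have dvd: "r dvd w k" if "x $ k \<noteq> 0" for k using dvd_weight_if_isotropy[OF r iso that] .
  define L where "L = ?e # v"
  define A where "A = 0 # a"
  have "\<exists>\<mu>. homogeneous_vector w r (a ! i) (v ! i - \<mu> *s ?e)" if "i < length a" for i
    using homogeneous_lift[OF r iso w, of "v ! i" "a ! i"] x act[OF that] by blast
  then obtain \<mu> where \<mu>: "\<And>i. i < length a \<Longrightarrow> homogeneous_vector w r (a ! i) (v ! i - \<mu> i *s ?e)"
    by metis
  have "\<exists>u. ?J *v u = axis j 1 \<and> homogeneous_vector w r (- int (d j)) u" for j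
    using homogeneous_preimage_axis[OF qs x dvd, of j] by metis
  then obtain u where u: "\<And>j. ?J *v u j = axis j 1" "\<And>j. homogeneous_vector w r (- int (d j)) (u j)"
    by metis
  \<comment> \<open>The value \<open>0\<close> at index \<open>0\<close> leaves the Euler vector
    itself unchanged.\<close>
  define \<nu> where "\<nu> i = (case i of 0 \<Rightarrow> 0 | Suc i \<Rightarrow> \<mu> i)" for i
  define b where "b = case_sum (\<lambda>i. L ! i - \<nu> i *s ?e) u"
  define cl where "cl = case_sum (\<lambda>i. A ! i) (\<lambda>j. - int (d j))"
  define K where "K = {..<length L} <+> (UNIV :: 'm set)"
  have J0: "?J *v y = 0" if "y \<in> set L" for y
    using that span vec.span_base[of y "set L"] by (auto simp: L_def cone_tangent_space_def)
  have sumK: "(\<Sum>k\<in>K. f k) = (\<Sum>i<length L. f (Inl i)) + (\<Sum>j\<in>UNIV. f (Inr j))"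
    for f :: "nat + 'm \<Rightarrow> 'z::comm_monoid_add"
    unfolding K_def by (simp add: sum.Plus)
  have "(\<Sum>k\<in>K. \<phi> (cl k)) = (\<Sum>i\<in>UNIV. \<phi> (- int (w i)))"
  proof (rule sum_over_homogeneous_basis[OF r, where b = b])
    show "finite K" by (simp add: K_def)
    show "homogeneous_vector w r (cl k) (b k)" if "k \<in> K" for k
    proof (cases k)
      case (Inl i)
      show ?thesis
      proof (cases i)
        case 0
        thus ?thesis using homogeneous_euler_vector[where x = x and w = w, OF dvd] Inl by (simp add: cl_def b_def L_def A_def \<nu>_def)
      next
        case (Suc i')
        thus ?thesis using \<mu>[of i'] len that Inl
          by (auto simp: cl_def b_def L_def A_def \<nu>_def K_def)
      qed
    next
      case (Inr j)
      thus ?thesis using u by (simp add: cl_def b_def)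
    qed
    show "\<phi> c = \<phi> c'" if "int r dvd c - c'" for c c' using \<phi> that .
  next
    fix s k assume 0: "(\<Sum>k\<in>K. s k *s b k) = 0" and k: "k \<in> K"
    let ?S = "(\<Sum>i<length L. s (Inl i) *s (L ! i - \<nu> i *s ?e))"
    have eq: "?S + (\<Sum>j\<in>UNIV. s (Inr j) *s u j) = 0"
      using 0 by (simp add: sumK b_def)
    have e: "?J *v ?e = 0" by (rule J0) (simp add: L_def)
    \<comment> \<open>The Jacobian kills the tangent part of the relation and sends the rest to a
      relation of the target axes, so the coefficients of \<open>u\<close> vanish.\<close>
    have JS: "?J *v ?S = 0"
      by (simp add: vec.sum vec.scale vec.diff J0 e)
    have Ju: "?J *v (\<Sum>j\<in>UNIV. s (Inr j) *s u j) = (\<Sum>j\<in>UNIV. s (Inr j) *s axis j 1)"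
      by (simp add: vec.sum vec.scale u)
    have "(\<Sum>j\<in>UNIV. s (Inr j) *s axis j 1) = ?J *v (?S + (\<Sum>j\<in>UNIV. s (Inr j) *s u j))"
      by (simp only: matrix_vector_right_distrib JS Ju add_0_left)
    also have "\<dots> = 0" unfolding eq by simp
    finally have "(\<Sum>j\<in>UNIV. s (Inr j) *s axis j 1) = (0 :: complex ^ 'm)" .
    moreover have "(\<Sum>j\<in>UNIV. s (Inr j) *s axis j 1) $ j = s (Inr j)" for j :: 'm
      by (simp add: axis_def if_distrib[of "\<lambda>x. _ * x"] cong: if_cong)
    ultimately have sr: "s (Inr j) = 0" for j by (metis zero_index)
    \<comment> \<open>The coefficients of the relation rewritten in \<open>L\<close>: all multiples
      of the Euler vector are gathered at index \<open>0\<close>.\<close>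
    define c where "c i = s (Inl i) - (if i = 0 then (\<Sum>i<length L. s (Inl i) * \<nu> i) else 0)" for i
    have L0: "L ! 0 = ?e" "0 < length L" by (simp_all add: L_def)
    have "(\<Sum>i<length L. c i *s L ! i) = (\<Sum>i<length L. s (Inl i) *s L ! i)
        - (\<Sum>i<length L. if i = 0 then (\<Sum>i<length L. s (Inl i) * \<nu> i) *s ?e else 0)"
      unfolding sum_subtractf[symmetric]
      by (rule sum.cong) (auto simp: c_def L0 vec.scale_left_diff_distrib)
    also have "\<dots> = (\<Sum>i<length L. s (Inl i) *s L ! i) - (\<Sum>i<length L. s (Inl i) * \<nu> i) *s ?e"
      using L0(2) by simp
    also have "\<dots> = ?S"
      by (simp add: vec.scale_right_diff_distrib sum_subtractf vec.scale_sum_left)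
    also have "\<dots> = 0" using eq sr by simp
    finally have "c i = 0" if "i < length L" for i
      using independent_list_coeffs[of L c i] ind dist that by (simp add: L_def)
    hence c: "s (Inl i) = (if i = 0 then (\<Sum>i<length L. s (Inl i) * \<nu> i) else 0)" if "i < length L" for i
      using that by (simp add: c_def)
    have "s (Inl i) * \<nu> i = 0" if "i < length L" for i
      using c[OF that] by (cases i) (simp_all add: \<nu>_def)
    hence "(\<Sum>i<length L. s (Inl i) * \<nu> i) = 0" by (intro sum.neutral) auto
    hence sl: "s (Inl i) = 0" if "i < length L" for i using c[OF that] by simp
    show "s k = 0" using k sl sr by (auto simp: K_def)
  next
    \<comment> \<open>Subtracting a combination of the \<open>u j\<close> with the same image moves
      \<open>y\<close> into the kernel, which \<open>L\<close> spans; this bounds the dimension by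
      the size of \<open>K\<close>.\<close>
    have "y \<in> vec.span (set L \<union> range u)" for y
    proof -
      have "?J *v (\<Sum>j\<in>UNIV. (?J *v y) $ j *s u j) = ?J *v y"
        by (simp add: vec.sum vec.scale u basis_expansion)
      hence "y - (\<Sum>j\<in>UNIV. (?J *v y) $ j *s u j) \<in> vec.span (set L)"
        using span by (simp add: L_def cone_tangent_space_def vec.diff)
      hence "y - (\<Sum>j\<in>UNIV. (?J *v y) $ j *s u j) \<in> vec.span (set L \<union> range u)"
        using vec.span_mono[of "set L" "set L \<union> range u"] by auto
      moreover have "(\<Sum>j\<in>UNIV. (?J *v y) $ j *s u j) \<in> vec.span (set L \<union> range u)"
        by (intro vec.span_sum vec.span_scale vec.span_base) auto
      ultimately show ?thesis using vec.span_add by fastforce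
    qed
    hence "vec.dim (UNIV :: (complex ^ 'n) set) \<le> card (set L \<union> range u)"
      by (intro vec.dim_le_card) auto
    also have "\<dots> \<le> card (set L) + card (range u)" by (rule card_Un_le)
    also have "\<dots> \<le> length L + CARD('m)" by (intro add_mono card_length card_image_le) simp
    also have "\<dots> = card K" by (simp add: K_def card_Plus)
    finally show "CARD('n) \<le> card K" by (simp add: card_cart_basis)
  qed
  moreover have "(\<Sum>i<length L. \<phi> (A ! i)) = \<phi> 0 + (\<Sum>i<length a. \<phi> (a ! i))"
    using len by (simp add: L_def A_def sum.lessThan_Suc_shift del: sum.lessThan_Suc)
  ultimately show ?thesis by (simp add: sumK cl_def)
qed

text \<open>The tangent space is stable under the projections to the classes, hence spanned by
  homogeneous vectors, and the Euler vector extends to a basis of such vectors. Existence is what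
  lets a condition on all local types say something at a given point.\<close>

theorem local_quotient_type_exists:
  assumes qs: "quasismooth_complete_intersection w d P" and x: "x \<in> affine_cone P - {0}"
  obtains r a where "local_quotient_type w P x r a"
proof -
  let ?e = "euler_vector w x" and ?J = "jacobian P x" and ?T = "cone_tangent_space P x"
  have w: "\<And>k. w k > 0" and hom: "\<And>j. weighted_homogeneous w (d j) (P j)"
    using qs by (auto simp: quasismooth_complete_intersection_def)
  obtain r where r: "r > 0" and iso: "isotropy_group w x = {t. t ^ r = 1}"
    using isotropy_group_eq[of w x] w x by auto
  have dvd: "r dvd w k" if "x $ k \<noteq> 0" for k using dvd_weight_if_isotropy[OF r iso that] .
  define H where "H = {v \<in> ?T. \<exists>c. homogeneous_vector w r c v}"
  have "?J *v ?e = 0"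
    using x jacobian_euler_vector[where P = P, OF hom] by (simp add: vec_eq_iff affine_cone_def)
  hence eH: "?e \<in> H" using homogeneous_euler_vector[where x = x and w = w, OF dvd] by (auto simp: H_def cone_tangent_space_def)
  have "?e \<noteq> 0" using x w by (auto simp: vec_eq_iff euler_vector_nth) 
  hence "vec.independent {?e}" by simp
  then obtain B where B: "{?e} \<subseteq> B" "B \<subseteq> H" "vec.independent B" "H \<subseteq> vec.span B"
    using vec.maximal_independent_subset_extend[of "{?e}" H] eH by auto
  have "vec.span B = ?T"
  proof
    show "vec.span B \<subseteq> ?T"
      using B(2) by (intro vec.span_minimal subspace_cone_tangent_space) (auto simp: H_def)
    show "?T \<subseteq> vec.span B"
    proof
      fix v assume v: "v \<in> ?T"
      have "vector_component w r c v \<in> H" for c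
      proof -
        have "?J *v vector_component w r c v = 0"
          using v jacobian_vector_component[where P = P and w = w and x = x, OF hom dvd]
          by (simp add: vec_eq_iff cone_tangent_space_def)
        thus ?thesis using homogeneous_vector_component[of w r c v] by (auto simp: H_def cone_tangent_space_def)
      qed
      hence "(\<Sum>c\<in>{0..<int r}. vector_component w r c v) \<in> vec.span B"
        using B(4) by (intro vec.span_sum) blast
      thus "v \<in> vec.span B" by (simp add: sum_vector_component[OF r])
    qed
  qed
  have "finite (B - {?e})" using vec.finiteI_independent[OF B(3)] by simp
  then obtain v where v: "set v = B - {?e}" "distinct v" using finite_distinct_list by blast
  have setL: "set (?e # v) = B" using v B(1) by auto
  have "\<forall>y\<in>B. \<exists>c. homogeneous_vector w r c y" using B(2) by (auto simp: H_def)
  then obtain c where c: "\<And>y. y \<in> B \<Longrightarrow> homogeneous_vector w r (c y) y" by metis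
  have "wact w t (v ! i) - t powi (map c v ! i) *s v ! i \<in> vec.span {?e}"
    if "i < length v" "t \<in> isotropy_group w x" for i t
  proof -
    have "v ! i \<in> B" using v that nth_mem by blast
    moreover have "t ^ r = 1" "t \<noteq> 0" using that iso by (auto simp: mem_isotropy_group_iff)
    ultimately show ?thesis
      using wact_homogeneous_vector[OF c] that by (simp add: vec.span_zero)
  qed
  hence "local_quotient_type w P x r (map c v)"
    unfolding local_quotient_type_def
    using r iso v setL B(3) \<open>vec.span B = ?T\<close> by (intro conjI exI[of _ v]) auto
  thus thesis by (rule that)
qed

section \<open>Fractional parts\<close>

lemma frac_eq_if_diff_Ints: "x - y \<in> \<int> \<Longrightarrow> frac x = frac (y :: real)"
proof -
  assume "x - y \<in> \<int>"
  then obtain n where "x - y = of_int n" by (rule Ints_cases)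
  hence "x = y + of_int n" by simp
  thus ?thesis by (simp add: frac_def)
qed

text \<open>Take for \<open>\<phi>\<close> the fractional part of \<open>- f * c\<close>. As
  \<open>f = 1 - k / r\<close>, it equals that of \<open>k * c / r\<close>, and it vanishes at the
  class \<open>0\<close> of the Euler vector.\<close>

lemma local_weights_frac_sum:
  assumes qs: "quasismooth_complete_intersection w d P" and x: "x \<in> affine_cone P - {0}"
    and type: "local_quotient_type w P x r a" and k: "k < r" and f: "f = real (r - k) / real r"
  shows "(\<Sum>i<length a. frac (real k * real_of_int (a ! i) / real r)) =
      (\<Sum>i\<in>UNIV. frac (f * real (w i))) - (\<Sum>j\<in>UNIV. frac (f * real (d j)))"
proof -
  define \<phi> where "\<phi> c = frac (- (f * real_of_int c))" for c
  have r: "real r \<noteq> 0" using k by simp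
  have periodic: "\<phi> c = \<phi> c'" if "int r dvd c - c'" for c c'
  proof -
    from that obtain q where "c - c' = int r * q" by (elim dvdE)
    hence "real_of_int c - real_of_int c' = real r * real_of_int q" by (metis of_int_diff of_int_mult of_int_of_nat_eq)
    hence "f * (real_of_int c - real_of_int c') = of_int (int (r - k) * q)" using r by (simp add: f)
    hence "- (f * real_of_int c) - - (f * real_of_int c') = of_int (- (int (r - k) * q))"
      by (simp add: algebra_simps)
    thus ?thesis unfolding \<phi>_def by (metis Ints_of_int frac_eq_if_diff_Ints)
  qed
  have "\<phi> c = frac (real k * real_of_int c / real r)" for c
    unfolding \<phi>_def
  proof (rule frac_eq_if_diff_Ints)
    have "- (f * real_of_int c) - real k * real_of_int c / real r = of_int (- c)"
      using r k by (simp add: f of_nat_diff field_simps)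
    thus "- (f * real_of_int c) - real k * real_of_int c / real r \<in> \<int>" by (simp only: Ints_of_int)
  qed
  thus ?thesis
    using sum_over_local_weights[OF qs x type, of \<phi>, OF periodic] by (simp add: \<phi>_def)
qed

text \<open>Take for \<open>\<phi>\<close> the indicator of \<open>f * c\<close> being an integer.
  The class \<open>0\<close> of the Euler vector contributes the \<open>1\<close> that makes the
  inequality strict.\<close>

lemma local_weights_card_less:
  assumes qs: "quasismooth_complete_intersection w d P" and x: "x \<in> affine_cone P - {0}"
    and type: "local_quotient_type w P x r a" and f: "f = real m / real r" and r: "r > 0"
  shows "card {j. real (d j) * f \<in> \<int>} < card {i. real (w i) * f \<in> \<int>}"
proof -
  define \<phi> where "\<phi> c = (of_bool (f * real_of_int c \<in> \<int>) :: real)" for c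
  have periodic: "\<phi> c = \<phi> c'" if "int r dvd c - c'" for c c'
  proof -
    from that obtain q where "c - c' = int r * q" by (elim dvdE)
    hence c: "real_of_int c = real_of_int c' + real r * real_of_int q"
      by (metis add.commute diff_add_cancel of_int_add of_int_mult of_int_of_nat_eq)
    have "f * real_of_int c = f * real_of_int c' + of_int (int m * q)"
      unfolding c f using r by (simp add: field_simps)
    hence "f * real_of_int c \<in> \<int> \<longleftrightarrow> f * real_of_int c' \<in> \<int>"
      by (metis Ints_of_int Ints_add Ints_diff add_diff_cancel_right')
    thus ?thesis by (simp add: \<phi>_def)
  qed
  have "real (card {i. real (w i) * f \<in> \<int>}) = (\<Sum>i\<in>UNIV. \<phi> (- int (w i)))"
    by (simp add: \<phi>_def minus_in_Ints_iff mult.commute)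
  also have "\<dots> = 1 + (\<Sum>i<length a. \<phi> (a ! i)) + (\<Sum>j\<in>UNIV. \<phi> (- int (d j)))"
    using sum_over_local_weights[OF qs x type, of \<phi>, OF periodic] by (simp add: \<phi>_def)
  also have "(\<Sum>j\<in>UNIV. \<phi> (- int (d j))) = real (card {j. real (d j) * f \<in> \<int>})"
    by (simp add: \<phi>_def minus_in_Ints_iff mult.commute)
  finally show ?thesis
    using sum_nonneg[of "{..<length a}" "\<lambda>i. \<phi> (a ! i)"] by (simp add: \<phi>_def)
qed

text \<open>A common divisor \<open>g > 1\<close> of \<open>r\<close> and all weights but one makes the Reid--Tai sum for
  \<open>k = r / g\<close> consist of a single fractional part.\<close>

lemma reid_tai_imp_well_formed_weights:
  assumes r: "r > 0" and rt: "reid_tai r a"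
  shows "well_formed_weights r a"
  unfolding well_formed_weights_def
proof (intro allI impI, rule ccontr)
  fix i assume i: "i < length a"
  define g where "g = nat (Gcd (insert (int r) ((!) a ` ({..<length a} - {i}))))"
  assume "Gcd (insert (int r) ((!) a ` ({..<length a} - {i}))) \<noteq> 1"
  hence g1: "g \<noteq> 1" by (simp add: g_def nat_eq_iff)
  have int_g: "int g = Gcd (insert (int r) ((!) a ` ({..<length a} - {i})))"
    by (simp add: g_def)
  have "int g dvd int r" unfolding int_g by (rule Gcd_dvd) simp
  then obtain n where n: "r = g * n" by (auto elim: dvdE)
  have g2: "g > 1" and n0: "n > 0" using g1 n r by (auto intro: Nat.gr0I) 
  hence nr: "n \<in> {1..<r}" using n by simp
  have zero: "frac (real n * real_of_int (a ! j) / real r) = 0" if "j \<in> {..<length a} - {i}" for j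
  proof -
    have "int g dvd a ! j" unfolding int_g using that by (intro Gcd_dvd) simp
    then obtain q where "a ! j = int g * q" by (elim dvdE)
    hence "real n * real_of_int (a ! j) / real r = of_int q" using g2 n0 by (simp add: n)
    thus ?thesis by simp
  qed
  have "(\<Sum>j\<in>{..<length a} - {i}. frac (real n * real_of_int (a ! j) / real r)) = 0"
    by (rule sum.neutral) (use zero in blast)
  hence "(\<Sum>j<length a. frac (real n * real_of_int (a ! j) / real r)) = frac (real n * real_of_int (a ! i) / real r)"
    using i by (simp add: sum.remove[of "{..<length a}" i])
  moreover have "(\<Sum>j<length a. frac (real n * real_of_int (a ! j) / real r)) > 1"
    using rt nr by (simp add: reid_tai_def)
  ultimately show False using frac_lt_1[of "real n * real_of_int (a ! i) / real r"] by simp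
qed

section \<open>Weight fractions and the points of the cone that realise them\<close>

lemma weight_fractionsI: "a < w i \<Longrightarrow> real a / real (w i) \<in> weight_fractions w"
  by (auto simp: weight_fractions_def)

lemma weight_fractions_bounds:
  assumes "f \<in> weight_fractions w - {0}"
  shows "0 < f" "f < 1"
  using assms by (auto simp: weight_fractions_def)

lemma one_minus_weight_fractions:
  assumes "f \<in> weight_fractions w - {0}"
  shows "1 - f \<in> weight_fractions w - {0}"
proof -
  obtain a i where f: "f = real a / real (w i)" "a < w i" using assms by (auto simp: weight_fractions_def)
  moreover have "a > 0" using assms f by (auto intro: Nat.gr0I)
  ultimately have "1 - f = real (w i - a) / real (w i)" "w i - a < w i" by (simp_all add: of_nat_diff field_simps)
  hence "1 - f \<in> weight_fractions w" by (metis weight_fractionsI)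
  thus ?thesis using weight_fractions_bounds[OF assms] by simp
qed

lemma weighted_homogeneous_mvar: "weighted_homogeneous w (w i) (mvar i)"
  by (simp add: weighted_homogeneous_def mvar_def mmonom_def lookup_single when_def if_distrib[of "\<lambda>x. x * _"] cong: if_cong)

lemma mpoly_eval_mvar: "mpoly_eval (mvar i) x = x $ i"
proof -
  have "(\<Prod>k\<in>UNIV. (x $ k) ^ Poly_Mapping.lookup (Poly_Mapping.single i 1) k) = (\<Prod>k\<in>UNIV. if k = i then x $ i else 1)"
    by (rule prod.cong) (auto simp: lookup_single when_def)
  thus ?thesis by (simp add: mpoly_eval_def mvar_def mmonom_def)
qed

text \<open>The equations with \<open>d j * f\<close> integral, together with the variables with
  \<open>w i * f\<close> not integral, are fewer than the coordinates and have a common non-zero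
  zero. Any other equation vanishes there: a monomial in the surviving variables has a degree whose
  product with \<open>f\<close> is an integer.\<close>

lemma cone_point_with_fraction:
  fixes w :: "'n::finite \<Rightarrow> nat" and d :: "'m::finite \<Rightarrow> nat"
  assumes qs: "quasismooth_complete_intersection w d P"
    and less: "card {j. real (d j) * f \<in> \<int>} < card {i. real (w i) * f \<in> \<int>}"
  obtains x where "x \<in> affine_cone P - {0}" "\<And>i. x $ i \<noteq> 0 \<Longrightarrow> real (w i) * f \<in> \<int>"
proof -
  have w: "\<And>k. w k > 0" and d: "\<And>j. d j > 0" and hom: "\<And>j. weighted_homogeneous w (d j) (P j)"
    using qs by (auto simp: quasismooth_complete_intersection_def)
  define S where "S = {i. real (w i) * f \<in> \<int>}"
  define T where "T = {j. real (d j) * f \<in> \<int>}"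
  define Q where "Q = P ` T \<union> mvar ` (- S)"
  have "card Q \<le> card T + card (- S)"
    unfolding Q_def by (rule order_trans[OF card_Un_le]) (intro add_mono card_image_le finite)
  also have "\<dots> < card S + card (- S)" using less by (simp add: S_def T_def)
  also have "\<dots> = CARD('n)" by (subst card_Un_disjoint[symmetric]) auto
  finally have "card Q < CARD('n)" .
  moreover have "finite Q" by (simp add: Q_def)
  moreover have "\<exists>e>0. weighted_homogeneous w e q" if "q \<in> Q" for q
    using that w d hom weighted_homogeneous_mvar unfolding Q_def by blast
  ultimately obtain x where x: "x \<noteq> 0" "\<And>q. q \<in> Q \<Longrightarrow> mpoly_eval q x = 0"
    using weighted_projective_intersection_nonempty by blast
  have supp: "i \<in> S" if "x $ i \<noteq> 0" for i
    using x(2)[of "mvar i"] that by (auto simp: Q_def mpoly_eval_mvar)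
  have "mpoly_eval (P j) x = 0" for j
  proof (cases "j \<in> T")
    case False
    show ?thesis unfolding mpoly_eval_def
    proof (rule sum.neutral, rule ballI, rule ccontr)
      fix \<alpha> assume \<alpha>: "\<alpha> \<in> Poly_Mapping.keys (P j)"
        and nz: "Poly_Mapping.lookup (P j) \<alpha> * (\<Prod>i\<in>UNIV. (x $ i) ^ Poly_Mapping.lookup \<alpha> i) \<noteq> 0"
      have "real (Poly_Mapping.lookup \<alpha> i) * (real (w i) * f) \<in> \<int>" for i
      proof (cases "Poly_Mapping.lookup \<alpha> i = 0")
        case False
        hence "x $ i \<noteq> 0" using nz by auto
        thus ?thesis using supp by (auto simp: S_def)
      qed simp
      hence "(\<Sum>i\<in>UNIV. real (Poly_Mapping.lookup \<alpha> i) * (real (w i) * f)) \<in> \<int>" by (intro Ints_sum)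
      also have "(\<Sum>i\<in>UNIV. real (Poly_Mapping.lookup \<alpha> i) * (real (w i) * f))
          = real (\<Sum>i\<in>UNIV. Poly_Mapping.lookup \<alpha> i * w i) * f"
        by (simp add: sum_distrib_right mult.assoc)
      also have "(\<Sum>i\<in>UNIV. Poly_Mapping.lookup \<alpha> i * w i) = d j"
        using hom \<alpha> by (simp add: weighted_homogeneous_def)
      finally show False using False by (simp add: T_def)
    qed
  qed (use x(2) in \<open>auto simp: Q_def\<close>)
  hence "x \<in> affine_cone P - {0}" using x(1) by (simp add: affine_cone_def)
  thus thesis using supp that by (auto simp: S_def)
qed

text \<open>The number \<open>cis (2 * pi * f)\<close> fixes \<open>x\<close>, hence is an
  \<open>r\<close>-th root of unity.\<close>

lemma isotropy_mult_fraction_Ints: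
  assumes "isotropy_group w x = {t. t ^ r = 1}" "\<And>i. x $ i \<noteq> 0 \<Longrightarrow> real (w i) * f \<in> \<int>"
  shows "real r * f \<in> \<int>"
proof -
  have "cis (2 * pi * f) ^ w k = 1" if "x $ k \<noteq> 0" for k
  proof -
    have "cis (2 * pi * f) ^ w k = cis (2 * pi * (real (w k) * f))"
      by (simp only: Complex.DeMoivre mult_ac)
    thus ?thesis using cis_multiple_2pi[OF assms(2)[OF that]] by simp
  qed
  hence "cis (2 * pi * f) \<in> isotropy_group w x" by (simp add: mem_isotropy_group_iff)
  hence "cis (real r * (2 * pi * f)) = 1" using assms(1) by (simp add: Complex.DeMoivre)
  hence "cos (real r * (2 * pi * f)) = 1" by (simp add: complex_eq_iff)
  then obtain n :: int where "real r * (2 * pi * f) = of_int n * 2 * pi"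
    by (auto simp: cos_one_2pi_int)
  hence "real r * f = of_int n" by simp
  thus ?thesis by (simp only: Ints_of_int)
qed

lemma weight_fractions_if_isotropy:
  assumes w: "\<And>k. w k > 0" and x: "x \<noteq> 0" and r: "r > 0" "isotropy_group w x = {t. t ^ r = 1}"
    and k: "k \<in> {1..<r}"
  shows "real (r - k) / real r \<in> weight_fractions w - {0}"
proof -
  obtain i where "x $ i \<noteq> 0" using x by (auto simp: vec_eq_iff)
  then obtain q where q: "w i = r * q" using dvd_weight_if_isotropy[OF r] by (auto elim: dvdE)
  have "q > 0" using w[of i] q by (auto intro: Nat.gr0I)
  hence "real (r - k) / real r = real ((r - k) * q) / real (w i)" "(r - k) * q < w i"
    using k by (simp_all add: q)
  hence "real (r - k) / real r \<in> weight_fractions w" by (metis weight_fractionsI)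
  thus ?thesis using k by simp
qed

text \<open>A fraction that fails both alternatives is realised at a point of the cone and
  contradicts Reid--Tai there. Conversely, each \<open>k\<close> at a point gives a fraction for
  which the strict comparison of cardinalities leaves only the second alternative.\<close>

theorem terminal_iff_fractions:
  assumes qs: "quasismooth_complete_intersection w d P"
  shows "well_formed w P \<and> terminal_singularities w P \<longleftrightarrow>
            (\<forall>f\<in>weight_fractions w - {0}.
               card {j. real (d j) * f \<in> \<int>} \<ge> card {i. real (w i) * f \<in> \<int>} \<or>
               (\<Sum>i\<in>UNIV. frac (f * real (w i))) > 1 + (\<Sum>j\<in>UNIV. frac (f * real (d j))))"
    (is "?L \<longleftrightarrow> ?R")
proof
  assume ?L
  show ?R
  proof (intro ballI, rule ccontr)
    fix f assume f: "f \<in> weight_fractions w - {0}"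
    assume "\<not> (card {j. real (d j) * f \<in> \<int>} \<ge> card {i. real (w i) * f \<in> \<int>} \<or>
               (\<Sum>i\<in>UNIV. frac (f * real (w i))) > 1 + (\<Sum>j\<in>UNIV. frac (f * real (d j))))"
    hence less: "card {j. real (d j) * f \<in> \<int>} < card {i. real (w i) * f \<in> \<int>}"
      and no: "\<not> (\<Sum>i\<in>UNIV. frac (f * real (w i))) > 1 + (\<Sum>j\<in>UNIV. frac (f * real (d j)))" by auto
    obtain x where x: "x \<in> affine_cone P - {0}" "\<And>i. x $ i \<noteq> 0 \<Longrightarrow> real (w i) * f \<in> \<int>"
      using cone_point_with_fraction[OF qs less] by blast
    obtain r a where type: "local_quotient_type w P x r a" using local_quotient_type_exists[OF qs x(1)] by blast
    hence r: "r > 0" "isotropy_group w x = {t. t ^ r = 1}" by (auto simp: local_quotient_type_def)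
    obtain m where m: "real r * f = of_int m"
      using isotropy_mult_fraction_Ints[OF r(2) x(2)] by (auto elim: Ints_cases)
    have "0 < real r * f" "real r * f < real r" using r weight_fractions_bounds[OF f] by simp_all
    hence m_bounds: "0 < m" "m < int r" unfolding m by simp_all
    define k where "k = r - nat m"
    have k: "k \<in> {1..<r}" "k < r" "real (r - k) = of_int m" using m_bounds by (auto simp: k_def)
    have "f = real (r - k) / real r" using m r k by (simp add: field_simps)
    hence "(\<Sum>i<length a. frac (real k * real_of_int (a ! i) / real r)) =
      (\<Sum>i\<in>UNIV. frac (f * real (w i))) - (\<Sum>j\<in>UNIV. frac (f * real (d j)))"
      by (rule local_weights_frac_sum[OF qs x(1) type k(2)])
    moreover have "reid_tai r a" using \<open>?L\<close> x(1) type by (auto simp: terminal_singularities_def)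
    hence "(\<Sum>i<length a. frac (real k * real_of_int (a ! i) / real r)) > 1"
      using k(1) unfolding reid_tai_def by blast
    ultimately show False using no by linarith
  qed
next
  assume R: ?R
  have w: "\<And>k. w k > 0" using qs by (auto simp: quasismooth_complete_intersection_def)
  have "reid_tai r a" if x: "x \<in> affine_cone P - {0}" and type: "local_quotient_type w P x r a" for x r a
    unfolding reid_tai_def
  proof
    fix k assume k: "k \<in> {1..<r}"
    have r: "r > 0" "isotropy_group w x = {t. t ^ r = 1}" using type by (auto simp: local_quotient_type_def)
    define f where "f = real (r - k) / real r"
    have "f \<in> weight_fractions w - {0}"
      unfolding f_def using x by (intro weight_fractions_if_isotropy[OF w _ r k]) auto
    moreover have "card {j. real (d j) * f \<in> \<int>} < card {i. real (w i) * f \<in> \<int>}"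
      by (rule local_weights_card_less[OF qs x type f_def r(1)])
    ultimately have "(\<Sum>i\<in>UNIV. frac (f * real (w i))) > 1 + (\<Sum>j\<in>UNIV. frac (f * real (d j)))"
      using R by (meson not_le)
    thus "(\<Sum>i<length a. frac (real k * real_of_int (a ! i) / real r)) > 1"
      using local_weights_frac_sum[OF qs x type _ f_def] k by simp
  qed
  moreover have "r > 0" if "local_quotient_type w P x r a" for x r a
    using that by (simp add: local_quotient_type_def)
  ultimately show ?L
    unfolding well_formed_def terminal_singularities_def
    using reid_tai_imp_well_formed_weights by blast
qed

section \<open>Ceilings and the starred condition\<close>

lemma ceiling_eq_frac: "real_of_int \<lceil>y\<rceil> = y + frac (- y)"
  by (simp add: frac_def ceiling_def)

text \<open>A ceiling exceeds \<open>y\<close> by the fractional part of \<open>- y\<close>, and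
  \<open>- f * n\<close> and \<open>(1 - f) * n\<close> differ by an integer. This is where
  \<open>f\<close> is exchanged with \<open>1 - f\<close>.\<close>

lemma sum_ceiling_eq_frac:
  "(\<Sum>i\<in>A. real_of_int \<lceil>f * real (v i)\<rceil>) =
     f * (\<Sum>i\<in>A. real (v i)) + (\<Sum>i\<in>A. frac ((1 - f) * real (v i)))"
proof -
  have frac: "frac (- (f * real n)) = frac ((1 - f) * real n)" for n
    by (rule frac_eq_if_diff_Ints) (simp add: algebra_simps)
  show ?thesis by (simp add: ceiling_eq_frac frac sum.distrib sum_distrib_left)
qed

lemma ceiling_sum_difference:
  "real_of_int ((\<Sum>j\<in>UNIV. \<lceil>f * real (d j)\<rceil>) - (\<Sum>i\<in>UNIV. \<lceil>f * real (w i)\<rceil>)) =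
     f * real_of_int (canonical_degree w d)
     + (\<Sum>j\<in>UNIV. frac ((1 - f) * real (d j))) - (\<Sum>i\<in>UNIV. frac ((1 - f) * real (w i)))"
  by (simp add: canonical_degree_def sum_ceiling_eq_frac right_diff_distrib)

lemma Ints_mult_one_minus: "real n * (1 - f) \<in> \<int> \<longleftrightarrow> real n * f \<in> \<int>"
proof -
  have "real n * (1 - f) = real n - real n * f" "real n * f = real n - real n * (1 - f)"
    by (simp_all add: algebra_simps)
  thus ?thesis by (metis Ints_diff Ints_of_nat)
qed

theorem proposition1p10:
  fixes w :: "'n::finite \<Rightarrow> nat" and d :: "'m::finite \<Rightarrow> nat" and P :: "'m \<Rightarrow> 'n mpoly"
  assumes "quasismooth_complete_intersection w d P"
  shows "((well_formed w P \<and> terminal_singularities w P) \<longleftrightarrow>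
            (\<forall>f\<in>weight_fractions w - {0}.
               card {j. real (d j) * f \<in> \<int>} \<ge> card {i. real (w i) * f \<in> \<int>} \<or>
               (\<Sum>i\<in>UNIV. frac (f * real (w i))) > 1 + (\<Sum>j\<in>UNIV. frac (f * real (d j)))))
       \<and> (canonical_degree w d \<le> 0 \<and> well_formed w P \<and> terminal_singularities w P
            \<longrightarrow> star_condition w d)
       \<and> (canonical_degree w d = 0
            \<longrightarrow> (star_condition w d \<longleftrightarrow> well_formed w P \<and> terminal_singularities w P))"
proof -
  define C where "C f \<longleftrightarrow> card {j. real (d j) * f \<in> \<int>} \<ge> card {i. real (w i) * f \<in> \<int>}" for f
  define G where "G f \<longleftrightarrow> (\<Sum>i\<in>UNIV. frac (f * real (w i))) > 1 + (\<Sum>j\<in>UNIV. frac (f * real (d j)))" for f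
  define s where "s f = (\<Sum>j\<in>UNIV. \<lceil>f * real (d j)\<rceil>) - (\<Sum>i\<in>UNIV. \<lceil>f * real (w i)\<rceil>)" for f
  have terminal: "well_formed w P \<and> terminal_singularities w P \<longleftrightarrow> (\<forall>f\<in>weight_fractions w - {0}. C f \<or> G f)"
    using terminal_iff_fractions[OF assms] by (simp add: C_def G_def)
  have star: "star_condition w d \<longleftrightarrow> (\<forall>f\<in>weight_fractions w - {0}. s f < - 1 \<or> C f)"
    by (simp add: star_condition_def C_def s_def)
  have C_flip: "C (1 - f) \<longleftrightarrow> C f" for f by (simp add: C_def Ints_mult_one_minus)
  \<comment> \<open>Up to the term \<open>f * canonical_degree w d\<close>, this inequality is
    \<open>G (1 - f)\<close>; the term is non-positive in the first application and zero in the
    second.\<close>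
  have s: "s f < - 1 \<longleftrightarrow> f * real_of_int (canonical_degree w d)
      + (\<Sum>j\<in>UNIV. frac ((1 - f) * real (d j))) - (\<Sum>i\<in>UNIV. frac ((1 - f) * real (w i))) < - 1" for f
    unfolding ceiling_sum_difference[symmetric] s_def by linarith
  have 1: "star_condition w d"
    if K: "canonical_degree w d \<le> 0" and t: "well_formed w P \<and> terminal_singularities w P"
    unfolding star
  proof
    fix f assume f: "f \<in> weight_fractions w - {0}"
    have "f * real_of_int (canonical_degree w d) \<le> 0"
      using weight_fractions_bounds[OF f] K by (simp add: mult_nonneg_nonpos)
    moreover have "C (1 - f) \<or> G (1 - f)" using t one_minus_weight_fractions[OF f] unfolding terminal by blast
    ultimately show "s f < - 1 \<or> C f" by (auto simp: C_flip s G_def)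
  qed
  have 2: "C f \<or> G f" if K: "canonical_degree w d = 0" and "star_condition w d"
    and f: "f \<in> weight_fractions w - {0}" for f
  proof -
    have "s (1 - f) < - 1 \<or> C (1 - f)" using that one_minus_weight_fractions[OF f] unfolding star by blast
    thus ?thesis by (auto simp: C_flip s G_def K)
  qed
  show ?thesis
    using terminal_iff_fractions[OF assms] 1 2 terminal by auto
qed

end
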